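(* For $q\in\mathbb{C}$ with $|q|<1$, $$\sum_{i,j\ge0}\frac{q^{\frac{3}{2}i^2-2ij+2j^2+\frac{1}{2}i-j}}{(q;q)_{2i}(q;q)_{2j}}=\sum_{i,j\ge0}\frac{q^{\frac{3}{2}i^2-2ij+2j^2-\frac{1}{2}i+j}}{(q;q)_{2i}(q;q)_{2j+1}}=\frac{1}{(q;q^2)_\infty^2(q^{2},q^{4},q^{10},q^{12};q^{14})_\infty},$$ $$\sum_{i,j\ge0}\frac{q^{\frac{3}{2}i^2-2ij+2j^2+\frac{3}{2}i-j}}{(q;q)_{2i+1}(q;q)_{2j}}=\sum_{i,j\ge0}\frac{q^{\frac{3}{2}i^2-2ij+2j^2+\frac{1}{2}i+j}}{(q;q)_{2i+1}(q;q)_{2j+1}}=\frac{1}{(q;q^2)_\infty^2(q^{2},q^{6},q^{8},q^{12};q^{14})_\infty},$$ $$\sum_{i,j\ge0}\frac{q^{\frac{3}{2}i^2-2ij+2j^2+\frac{5}{2}i-j}}{(q;q)_{2i+1}(q;q)_{2j}}=\sum_{i,j\ge0}\frac{q^{\frac{3}{2}i^2-2ij+2j^2+\frac{3}{2}i+j}}{(q;q)_{2i+1}(q;q)_{2j+1}}=\frac{1}{(q;q^2)_\infty^2(q^{4},q^{6},q^{8},q^{10};q^{14})_\infty}.$$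
   Context: For $|q|<1$: $(a;q)_\infty=\prod_{k\ge0}(1-aq^k)$; for integers $n\ge0$, $(a;q)_n=\prod_{k=0}^{n-1}(1-aq^k)$; and $(a_1,\dots,a_m;q)_\infty=\prod_{k=1}^m(a_k;q)_\infty$. All exponents of $q$ appearing are integers. *)

theory Defs
  imports "HOL-Analysis.Analysis"
begin

definition qpoch :: "complex \<Rightarrow> complex \<Rightarrow> nat \<Rightarrow> complex" where
  "qpoch a q n = (\<Prod>k<n. 1 - a * q ^ k)"

definition qpoch_inf :: "complex \<Rightarrow> complex \<Rightarrow> complex" where
  "qpoch_inf a q = (\<Prod>k. 1 - a * q ^ k)"

definition qpoch_inf_list :: "complex list \<Rightarrow> complex \<Rightarrow> complex" where
  "qpoch_inf_list as q = (\<Prod>a\<leftarrow>as. qpoch_inf a q)"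

text \<open>For \<open>norm q < 1\<close> the infinite product converges, vanishing factors included,
  so \<open>prodinf\<close> is the genuine limit of the partial products.\<close>

lemma qpoch_inf_has_prod:
  assumes "norm q < 1"
  shows "(\<lambda>k. 1 - a * q ^ k) has_prod qpoch_inf a q"
proof -
  have "summable (\<lambda>k. norm (a * q ^ k))"
    using assms by (simp add: norm_mult norm_power summable_mult summable_geometric)
  then have "abs_convergent_prod (\<lambda>k. 1 - a * q ^ k)"
    by (simp add: abs_convergent_prod_conv_summable)
  then have "convergent_prod (\<lambda>k. 1 - a * q ^ k)"
    by (rule abs_convergent_prod_imp_convergent_prod)
  then show ?thesis
    unfolding qpoch_inf_def by (rule convergent_prod_has_prod)
qed

lemma qpoch_tendsto_qpoch_inf:
  assumes "norm q < 1"
  shows "qpoch a q \<longlonglongrightarrow> qpoch_inf a q"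
proof -
  have "(\<lambda>n. \<Prod>k\<le>n. 1 - a * q ^ k) \<longlonglongrightarrow> qpoch_inf a q"
    using has_prod_imp_tendsto[OF qpoch_inf_has_prod[OF assms]] .
  then have "(\<lambda>n. qpoch a q (Suc n)) \<longlonglongrightarrow> qpoch_inf a q"
    by (simp add: qpoch_def lessThan_Suc_atMost del: prod.lessThan_Suc)
  then show ?thesis
    by (rule LIMSEQ_imp_Suc)
qed

end

(*
  Summing over j first: with n = 2j or n = 2j + 1, the j-sum is the even or odd part of Euler's
  series sum_n q^(n(n-1)/2) z^n / (q;q)_n = (-z;q)_inf at z = q^(-i).  Since (q^(-i);q)_inf = 0,
  both parts equal (-q^(-i);q)_inf / 2 = q^(-i(i+1)/2) (-q;q)_i (-q;q)_inf.  What remains is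
  (-q;q)_inf times one of Rogers' sums sum_i q^(i^2 + d i) (-q;q)_i / (q;q)_(2i+e) with
  (d, e) = (0, 0), (1, 1), (2, 1).  Each follows from a Bailey-type inversion: the factor
  (-q;q)_i / (q;q)_(2i+e) is sum_s (-1)^s q^(3s^2+s) / ((q;q)_(i-2s) (q;q)_(i+d+2s)), the sum over i
  of q^(i^2 + d i) / ((q;q)_(i-r) (q;q)_(i+d+r)) is q^(r^2 + d r) / (q;q)_inf, and the resulting
  sum_s (-1)^s q^(7s^2 + (2d+1)s) is a product by the Jacobi triple product identity.
*)

theory Submission
  imports Defs
begin

section \<open>Finite and infinite \<open>q\<close>-Pochhammer symbols\<close>

text \<open>The inversion is provable by elementary recurrences because the weight (-1)^s q^(3s^2+s)
  has two symmetries that match the two q-Pascal relations: one folds a term back onto another, the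
  other makes a term vanish. The 14 arises as 2 (3 + 4): the weight contributes 3 s^2, and r = 2s in
  q^(r^2) contributes 4 s^2. Only even r occur, and this is where d <= 2 enters: for larger d an
  even r could lie strictly between -d and 0, and there the sum over n >= 0 is a truncated series.
  The evaluation with 1/(q;q)_inf is used twice, once to prove the Jacobi triple product itself and
  once for the sum over n. Unconditional convergence (\<open>has_sum\<close>) justifies the
  exchanges of summation. The argument q^(-i) makes sense only for q nonzero, so q = 0 is settled on
  its own, where just the term i = j = 0 survives.\<close>

lemma qpoch_0 [simp]: "qpoch a q 0 = 1"
  by (simp add: qpoch_def)

lemma qpoch_Suc: "qpoch a q (Suc n) = qpoch a q n * (1 - a * q ^ n)"
  by (simp add: qpoch_def)

lemma qpoch_qq_Suc: "qpoch q q (Suc n) = qpoch q q n * (1 - q ^ Suc n)"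
  by (simp add: qpoch_def)

lemma one_minus_power_nonzero:
  fixes q :: complex
  assumes "norm q < 1" "n > 0"
  shows "1 - q ^ n \<noteq> 0"
proof
  assume "1 - q ^ n = 0"
  then have "norm q ^ n = 1"
    by (metis eq_iff_diff_eq_0 norm_one norm_power)
  then show False
    using assms power_less_one_iff[of "norm q" n] by simp
qed

lemma qpoch_inf_nonzero:
  assumes "norm a < 1" "norm q < 1"
  shows "qpoch_inf a q \<noteq> 0"
proof -
  have "1 - a * q ^ k \<noteq> 0" for k
  proof
    assume "1 - a * q ^ k = 0"
    then have "norm (a * q ^ k) = 1" by simp
    moreover have "norm (a * q ^ k) \<le> norm a"
      using assms by (simp add: norm_mult norm_power mult_left_le power_le_one)
    ultimately show False using assms by simp
  qed
  then show ?thesis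
    using has_prod_eq_0_iff[OF qpoch_inf_has_prod[OF assms(2), of a]] by force
qed

lemma qpoch_inf_eq_0:
  assumes "norm q < 1" "a * q ^ k = 1"
  shows "qpoch_inf a q = 0"
  using has_prod_eq_0_iff[OF qpoch_inf_has_prod[OF assms(1), of a]] assms(2) by force

text \<open>Group the exponents k < m n by their residue j modulo m.\<close>

lemma qpoch_dissect:
  assumes "m > 0"
  shows "qpoch a q (m * n) = (\<Prod>j<m. qpoch (a * q ^ j) (q ^ m) n)"
proof (induction n)
  case (Suc n)
  have "qpoch a q (m * Suc n) = qpoch a q (m * n) * (\<Prod>j<m. 1 - a * q ^ (m * n + j))"
  proof -
    have "qpoch a q (N + M) = qpoch a q N * (\<Prod>j<M. 1 - a * q ^ (N + j))" for N M
      by (induction M) (simp_all add: qpoch_Suc mult_ac)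
    from this[of "m * n" m] show ?thesis by (simp add: add.commute)
  qed
  then show ?case
    using Suc by (simp add: qpoch_Suc prod.distrib power_add power_mult mult_ac)
qed simp

lemma qpoch_inf_dissect:
  assumes "norm q < 1" "m > 0"
  shows "qpoch_inf a q = (\<Prod>j<m. qpoch_inf (a * q ^ j) (q ^ m))"
proof -
  have "norm (q ^ m) < 1"
    using assms by (simp add: norm_power power_less_one_iff)
  then have "(\<lambda>n. \<Prod>j<m. qpoch (a * q ^ j) (q ^ m) n) \<longlonglongrightarrow> (\<Prod>j<m. qpoch_inf (a * q ^ j) (q ^ m))"
    by (intro tendsto_prod qpoch_tendsto_qpoch_inf)
  moreover have "strict_mono ((*) m)"
    using assms(2) by (simp add: strict_mono_def)
  then have "(\<lambda>n. qpoch a q (m * n)) \<longlonglongrightarrow> qpoch_inf a q"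
    using LIMSEQ_subseq_LIMSEQ[OF qpoch_tendsto_qpoch_inf[OF assms(1)], of "(*) m" a]
    by (simp add: o_def)
  ultimately show ?thesis
    unfolding qpoch_dissect[OF assms(2)] by (rule LIMSEQ_unique[rotated])
qed

lemma qpoch_inf_square:
  assumes "norm q < 1"
  shows "qpoch_inf a q * qpoch_inf (-a) q = qpoch_inf (a ^ 2) (q ^ 2)"
proof -
  have "qpoch a q n * qpoch (-a) q n = qpoch (a ^ 2) (q ^ 2) n" for n
    by (induction n) (simp_all add: qpoch_Suc algebra_simps power2_eq_square power_mult_distrib)
  moreover have "(\<lambda>n. qpoch a q n * qpoch (-a) q n) \<longlonglongrightarrow> qpoch_inf a q * qpoch_inf (-a) q"
    using assms by (intro tendsto_mult qpoch_tendsto_qpoch_inf)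
  moreover have "qpoch (a ^ 2) (q ^ 2) \<longlonglongrightarrow> qpoch_inf (a ^ 2) (q ^ 2)"
    using assms by (intro qpoch_tendsto_qpoch_inf) (simp add: norm_power power_less_one_iff)
  ultimately show ?thesis
    by (simp add: LIMSEQ_unique)
qed

lemma qpoch_inf_split:
  assumes "norm q < 1"
  shows "qpoch_inf a q = qpoch a q n * qpoch_inf (a * q ^ n) q"
proof -
  have "qpoch a q (n + m) = qpoch a q n * qpoch (a * q ^ n) q m" for m
    by (induction m) (simp_all add: qpoch_Suc power_add mult_ac)
  moreover have "(\<lambda>m. qpoch a q (n + m)) \<longlonglongrightarrow> qpoch_inf a q"
    using LIMSEQ_ignore_initial_segment[OF qpoch_tendsto_qpoch_inf[OF assms, of a], of n]
    by (simp add: add.commute)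
  moreover have "(\<lambda>m. qpoch a q n * qpoch (a * q ^ n) q m) \<longlonglongrightarrow> qpoch a q n * qpoch_inf (a * q ^ n) q"
    using assms by (intro tendsto_mult tendsto_const qpoch_tendsto_qpoch_inf)
  ultimately show ?thesis
    by (simp add: LIMSEQ_unique)
qed

text \<open>Extending \<open>1/(q;q)\<^sub>n\<close> by zero to negative \<open>n\<close> makes the recurrence
  \<open>recip_qfact_shift\<close> hold for every integer.\<close>

definition recip_qfact :: "complex \<Rightarrow> int \<Rightarrow> complex" where
  "recip_qfact q n = (if n < 0 then 0 else 1 / qpoch q q (nat n))"

lemma recip_qfact_neg [simp]: "n < 0 \<Longrightarrow> recip_qfact q n = 0"
  and recip_qfact_of_nat [simp]: "recip_qfact q (int k) = 1 / qpoch q q k"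
  by (simp_all add: recip_qfact_def)

definition euler_coeff :: "complex \<Rightarrow> nat \<Rightarrow> complex" where
  "euler_coeff q n = q ^ (n * (n - 1) div 2) / qpoch q q n"

text \<open>Generating function of the partitions whose largest Durfee rectangle of shape k by k + m
  has k rows. Every partition has exactly one such k, which explains why the sum over k does not
  depend on m.\<close>

definition durfee_term :: "complex \<Rightarrow> nat \<Rightarrow> nat \<Rightarrow> complex" where
  "durfee_term q m k = q ^ (k * k + m * k) / (qpoch q q k * qpoch q q (k + m))"

context
  fixes q :: complex
  assumes q_less_1: "norm q < 1"
begin

lemma qpoch_qq_nonzero: "qpoch q q n \<noteq> 0"
  by (induction n) (use one_minus_power_nonzero[OF q_less_1] in \<open>simp_all add: qpoch_qq_Suc del: power_Suc\<close>)

lemma recip_qfact_shift: "(1 - q powi n) * recip_qfact q n = recip_qfact q (n - 1)"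
proof (cases "n > 0")
  case True
  then obtain k where "n = int (Suc k)"
    by (metis gr0_implies_Suc zero_less_imp_eq_int)
  moreover have "recip_qfact q (int (Suc k) - 1) = 1 / qpoch q q k"
    by simp
  moreover have "(1 - q ^ Suc k) * (1 / qpoch q q (Suc k)) = 1 / qpoch q q k"
    using qpoch_qq_nonzero[of "Suc k"]
    by (simp add: qpoch_qq_Suc field_simps del: power_Suc)
  ultimately show ?thesis
    by (simp only: recip_qfact_of_nat power_int_of_nat)
next
  case False
  \<comment> \<open>At n = 0 the factor 1 - q^0 vanishes, in agreement with the value 0 at -1; for n
    < 0 both sides are 0.\<close>
  then show ?thesis by (cases "n = 0") auto
qed

text \<open>The sequence 1/(q;q)_n converges because (q;q)_inf is nonzero. The uniform bound C feeds
  all later comparisons with geometric series.\<close>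

lemma recip_qfact_bounded:
  obtains C where "C > 0" "\<And>n. norm (recip_qfact q n) \<le> C"
proof -
  have "(\<lambda>n. 1 / qpoch q q n) \<longlonglongrightarrow> 1 / qpoch_inf q q"
    using qpoch_inf_nonzero[OF q_less_1 q_less_1] q_less_1
    by (intro tendsto_divide tendsto_const qpoch_tendsto_qpoch_inf)
  then have "Bseq (\<lambda>n. 1 / qpoch q q n)"
    by (meson convergentI convergent_imp_Bseq)
  then obtain C where C: "C > 0" "\<And>n. norm (1 / qpoch q q n) \<le> C"
    unfolding Bseq_def by auto
  have "norm (recip_qfact q n) \<le> C" for n
    using C(1) C(2)[of "nat n"] by (simp add: recip_qfact_def)
  with C(1) that show ?thesis by blast
qed

section \<open>Euler's series and a Cauchy-type series\<close>

lemma euler_coeff_Suc: "euler_coeff q (Suc n) * (1 - q ^ Suc n) = q ^ n * euler_coeff q n"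
proof -
  have "Suc n * (Suc n - 1) div 2 = n + n * (n - 1) div 2"
    by (cases n) (simp_all add: algebra_simps)
  then show ?thesis
    using one_minus_power_nonzero[OF q_less_1, of "Suc n"]
    by (simp add: euler_coeff_def qpoch_qq_Suc power_add del: power_Suc)
qed

text \<open>Ratio test: consecutive terms have ratio q^n z / (1 - q^(n+1)). The denominator has norm
  at least 1 - |q|, so the threshold (1 - |q|)/2 for |q^n z| gives the ratio 1/2.\<close>

lemma euler_summable_norm: "summable (\<lambda>n. norm (euler_coeff q n * z ^ n))"
proof -
  have "(\<lambda>n. q ^ n * z) \<longlonglongrightarrow> 0 * z"
    by (intro tendsto_mult tendsto_const LIMSEQ_power_zero q_less_1)
  moreover have "(1 - norm q) / 2 > 0"
    using q_less_1 by simp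
  ultimately have "eventually (\<lambda>n. norm (q ^ n * z) < (1 - norm q) / 2) sequentially"
    using tendstoD[of "\<lambda>n. q ^ n * z" "0 * z" sequentially "(1 - norm q) / 2"]
    by (simp only: mult_zero_left dist_0_norm dist_norm diff_zero)
  then obtain N where N: "\<And>n. n \<ge> N \<Longrightarrow> norm (q ^ n * z) < (1 - norm q) / 2"
    by (auto simp: eventually_sequentially)
  have "norm (euler_coeff q (Suc n) * z ^ Suc n) \<le> 1 / 2 * norm (euler_coeff q n * z ^ n)" if "n \<ge> N" for n
  proof -
    have le: "1 - norm q \<le> norm (1 - q ^ Suc n)"
    proof -
      have "norm q ^ Suc n \<le> norm q ^ 1"
        using q_less_1 by (intro power_decreasing) auto
      then show ?thesis
        using norm_triangle_ineq2[of 1 "q ^ Suc n"] by (simp add: norm_mult norm_power)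
    qed
    have "(1 - norm q) * norm (euler_coeff q (Suc n) * z ^ Suc n)
          \<le> norm (1 - q ^ Suc n) * norm (euler_coeff q (Suc n) * z ^ Suc n)"
      by (intro mult_right_mono le) auto
    also have "\<dots> = norm (euler_coeff q (Suc n) * (1 - q ^ Suc n) * z ^ Suc n)"
      by (simp add: norm_mult mult_ac)
    also have "\<dots> = norm (q ^ n * z) * norm (euler_coeff q n * z ^ n)"
      unfolding euler_coeff_Suc by (simp add: norm_mult norm_power mult_ac)
    also have "\<dots> \<le> (1 - norm q) / 2 * norm (euler_coeff q n * z ^ n)"
      using N[OF that] by (intro mult_right_mono) auto
    finally show ?thesis
      using q_less_1 by simp
  qed
  then show ?thesis
    using summable_ratio_test[of "1/2" N "\<lambda>n. norm (euler_coeff q n * z ^ n)"] by simp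
qed

text \<open>Passing from z to q z multiplies the n-th term by q^n. The difference therefore carries
  1 - q^n, which kills the term n = 0 and lets \<open>euler_coeff_Suc\<close> shift the remaining
  ones.\<close>

lemma euler_functional_equation:
  "(\<Sum>n. euler_coeff q n * z ^ n) = (1 + z) * (\<Sum>n. euler_coeff q n * (q * z) ^ n)"
proof -
  have S: "summable (\<lambda>n. euler_coeff q n * z ^ n)" for z
    using euler_summable_norm by (rule summable_norm_cancel)
  have "(\<Sum>n. euler_coeff q n * z ^ n) - (\<Sum>n. euler_coeff q n * (q * z) ^ n)
        = (\<Sum>n. euler_coeff q n * (1 - q ^ n) * z ^ n)"
    by (subst suminf_diff[OF S S]) (simp add: algebra_simps power_mult_distrib)
  also have "\<dots> = (\<Sum>n. euler_coeff q (Suc n) * (1 - q ^ Suc n) * z ^ Suc n)"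
  proof -
    have "summable (\<lambda>n. euler_coeff q n * (1 - q ^ n) * z ^ n)"
      using summable_diff[OF S[of z] S[of "q * z"]] by (simp add: algebra_simps power_mult_distrib)
    from suminf_split_head[OF this] show ?thesis by simp
  qed
  also have "\<dots> = (\<Sum>n. z * (euler_coeff q n * (q * z) ^ n))"
    unfolding euler_coeff_Suc by (simp add: power_mult_distrib mult_ac)
  also have "\<dots> = z * (\<Sum>n. euler_coeff q n * (q * z) ^ n)"
    by (intro suminf_mult S)
  finally show ?thesis by (simp add: algebra_simps)
qed

text \<open>Iterating the functional equation N times pulls out (-z;q)_N and leaves the series at z
  q^N, which tends to its value 1 at 0 by continuity.\<close>

theorem euler_sums: "(\<lambda>n. euler_coeff q n * z ^ n) sums qpoch_inf (-z) q"
proof -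
  have S: "summable (\<lambda>n. euler_coeff q n * z ^ n)" for z
    using euler_summable_norm by (rule summable_norm_cancel)
  define E where "E z = (\<Sum>n. euler_coeff q n * z ^ n)" for z
  have E: "E z = qpoch (-z) q N * E (z * q ^ N)" for N
  proof (induction N)
    case (Suc N)
    then show ?case
      using euler_functional_equation[of "z * q ^ N"]
      by (simp add: E_def qpoch_Suc mult_ac)
  qed simp
  have "isCont E 0"
    unfolding E_def by (intro isCont_powser_converges_everywhere S)
  moreover have "(\<lambda>N. z * q ^ N) \<longlonglongrightarrow> z * 0"
    by (intro tendsto_mult tendsto_const LIMSEQ_power_zero q_less_1)
  ultimately have "(\<lambda>N. E (z * q ^ N)) \<longlonglongrightarrow> E 0"
    using isCont_tendsto_compose[of 0 E "\<lambda>N. z * q ^ N" sequentially] by simp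
  moreover have "E 0 = 1"
    unfolding E_def powser_zero by (simp add: euler_coeff_def)
  ultimately have "(\<lambda>N. qpoch (-z) q N * E (z * q ^ N)) \<longlonglongrightarrow> qpoch_inf (-z) q * 1"
    by (intro tendsto_mult qpoch_tendsto_qpoch_inf q_less_1) simp
  then have "E z = qpoch_inf (-z) q"
    unfolding E[symmetric] by (simp add: LIMSEQ_const_iff)
  then show ?thesis
    using S[of z] unfolding E_def by (simp add: sums_iff)
qed

lemma euler_has_sum: "((\<lambda>n. euler_coeff q n * z ^ n) has_sum qpoch_inf (-z) q) UNIV"
  by (rule norm_summable_imp_has_sum[OF euler_summable_norm euler_sums])

text \<open>Weakening k^2 to k gives a geometric series in k; the factor |q|^(m k) is kept because
  \<open>durfee_sums\<close> also needs decay in m.\<close>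

lemma durfee_term_bound:
  obtains C where "C > 0" "\<And>m k. norm (durfee_term q m k) \<le> C * norm q ^ (k + m * k)"
proof -
  obtain C where C: "C > 0" "\<And>n. norm (recip_qfact q n) \<le> C"
    using recip_qfact_bounded by blast
  have "norm (durfee_term q m k) \<le> C * C * norm q ^ (k + m * k)" for m k
  proof -
    have "durfee_term q m k = q ^ (k * k + m * k) * (recip_qfact q (int k) * recip_qfact q (int (k + m)))"
      unfolding recip_qfact_of_nat durfee_term_def by simp
    then have "norm (durfee_term q m k)
        = norm q ^ (k * k + m * k) * (norm (recip_qfact q (int k)) * norm (recip_qfact q (int (k + m))))"
      by (simp only: norm_mult norm_power)
    also have "\<dots> \<le> norm q ^ (k + m * k) * (C * C)"
      using q_less_1 C(1) by (intro mult_mono power_decreasing C(2)) auto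
    finally show ?thesis by (simp add: mult_ac)
  qed
  with C(1) that[of "C * C"] show ?thesis by simp
qed

lemma durfee_summable_norm: "summable (\<lambda>k. norm (durfee_term q m k))"
proof -
  obtain C where C: "C > 0" "\<And>m k. norm (durfee_term q m k) \<le> C * norm q ^ (k + m * k)"
    using durfee_term_bound by blast
  have "norm (norm (durfee_term q m k)) \<le> C * norm q ^ k" for k
  proof -
    have "C * norm q ^ (k + m * k) \<le> C * norm q ^ k"
      using C(1) q_less_1 by (intro mult_left_mono power_decreasing) auto
    with C(2)[of m k] show ?thesis by simp
  qed
  moreover have "summable (\<lambda>k. C * norm q ^ k)"
    using q_less_1 by (intro summable_mult summable_geometric) simp
  ultimately show ?thesis
    using summable_comparison_test'[of "\<lambda>k. C * norm q ^ k" 0 "\<lambda>k. norm (durfee_term q m k)"] by simp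
qed

text \<open>Consecutive sums differ by \<open>D m = - q ^ (m + 1) * D (m + 1)\<close>, so they all agree with their
  limit for \<open>m \<rightarrow> \<infinity>\<close>.\<close>

theorem durfee_sums: "durfee_term q m sums (1 / qpoch_inf q q)"
proof -
  obtain C where C: "C > 0" "\<And>m k. norm (durfee_term q m k) \<le> C * norm q ^ (k + m * k)"
    using durfee_term_bound by blast
  have S: "summable (durfee_term q m)" for m
    using durfee_summable_norm by (rule summable_norm_cancel)
  define G where "G m = suminf (durfee_term q m)" for m
  define D where "D m = G m - G (Suc m)" for m
  \<comment> \<open>A contiguous relation: after naming the powers of q and the common q-factorials
    it is an identity of rational functions with nonzero denominators.\<close>
  have term_diff: "durfee_term q m (Suc k) - durfee_term q (Suc m) (Suc k)
      = q ^ Suc m * durfee_term q (Suc (Suc m)) k - q ^ Suc m * durfee_term q (Suc m) (Suc k)" for m k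
  proof -
    define A where "A = qpoch q q k"
    define B where "B = qpoch q q (Suc (k + m))"
    define x where "x = q ^ k"
    define y where "y = q ^ m"
    define z where "z = q ^ (k * k + m * k)"
    have nz: "A \<noteq> 0" "B \<noteq> 0" "1 - q * x \<noteq> 0" "1 - q * (q * (x * y)) \<noteq> 0"
      using qpoch_qq_nonzero one_minus_power_nonzero[OF q_less_1, of "Suc k"]
        one_minus_power_nonzero[OF q_less_1, of "Suc (Suc (k + m))"]
      by (simp_all add: A_def B_def x_def y_def power_add)
    have t: "durfee_term q m (Suc k) = q * x\<^sup>2 * y * z / (A * (1 - q * x) * B)"
      "durfee_term q (Suc m) (Suc k) = q\<^sup>2 * x ^ 3 * y * z / (A * (1 - q * x) * (B * (1 - q * (q * (x * y)))))"
      "durfee_term q (Suc (Suc m)) k = x\<^sup>2 * z / (A * (B * (1 - q * (q * (x * y)))))"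
      unfolding durfee_term_def A_def B_def x_def y_def z_def
      by (simp_all add: qpoch_qq_Suc power_add power2_eq_square power3_eq_cube mult_ac)
    show ?thesis
      unfolding t power_Suc using nz
      by (simp add: divide_simps flip: y_def) (simp add: algebra_simps power2_eq_square power3_eq_cube)
  qed
  \<comment> \<open>Sum \<open>term_diff\<close> over k. The difference of the two terms at k = 0 is
    exactly the term by which the shifted series falls short of \<open>G (Suc m)\<close>.\<close>
  have "D m = - (q ^ Suc m * D (Suc m))" for m
  proof -
    have "D m = (\<Sum>k. durfee_term q m k - durfee_term q (Suc m) k)"
      unfolding D_def G_def by (rule suminf_diff[OF S S])
    also have "\<dots> = durfee_term q m 0 - durfee_term q (Suc m) 0
                    + (\<Sum>k. durfee_term q m (Suc k) - durfee_term q (Suc m) (Suc k))"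
      using suminf_split_head[OF summable_diff[OF S S], of m "Suc m"] by simp
    also have "(\<Sum>k. durfee_term q m (Suc k) - durfee_term q (Suc m) (Suc k))
       = (\<Sum>k. q ^ Suc m * durfee_term q (Suc (Suc m)) k) - (\<Sum>k. q ^ Suc m * durfee_term q (Suc m) (Suc k))"
      unfolding term_diff
      by (rule suminf_diff[symmetric]) (intro summable_mult S | subst summable_Suc_iff)+
    also have "(\<Sum>k. q ^ Suc m * durfee_term q (Suc (Suc m)) k) = q ^ Suc m * G (Suc (Suc m))"
      unfolding G_def by (intro suminf_mult S)
    also have "(\<Sum>k. q ^ Suc m * durfee_term q (Suc m) (Suc k)) = q ^ Suc m * (\<Sum>k. durfee_term q (Suc m) (Suc k))"
      by (intro suminf_mult) (subst summable_Suc_iff, rule S)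
    also have "(\<Sum>k. durfee_term q (Suc m) (Suc k)) = G (Suc m) - durfee_term q (Suc m) 0"
      unfolding G_def by (rule suminf_split_head[OF S])
    also have "durfee_term q m 0 - durfee_term q (Suc m) 0 = - (q ^ Suc m * durfee_term q (Suc m) 0)"
      using qpoch_qq_nonzero[of m] one_minus_power_nonzero[OF q_less_1, of "Suc m"]
      by (simp add: durfee_term_def qpoch_qq_Suc divide_simps)
    finally show ?thesis by (simp add: D_def algebra_simps)
  qed
  \<comment> \<open>The term k = 0 is 1/(q;q)_m; all the others together are O(|q|^m).\<close>
  have G_limit: "norm (G m - 1 / qpoch q q m) \<le> norm q ^ m * (C / (1 - norm q))" for m
  proof -
    have "G m - 1 / qpoch q q m = (\<Sum>k. durfee_term q m (Suc k))"
      unfolding G_def using suminf_split_head[OF S, of m] by (simp add: durfee_term_def)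
    also have "norm \<dots> \<le> (\<Sum>k. norm (durfee_term q m (Suc k)))"
      by (rule summable_norm) (subst summable_Suc_iff[of "\<lambda>k. norm (durfee_term q m k)"], rule durfee_summable_norm)
    also have "\<dots> \<le> (\<Sum>k. norm q ^ m * C * norm q ^ k)"
    proof (rule suminf_le)
      fix k
      have "norm (durfee_term q m (Suc k)) \<le> C * norm q ^ (Suc k + m * Suc k)"
        by (rule C)
      also have "\<dots> \<le> C * norm q ^ (m + k)"
        using C(1) q_less_1 by (intro mult_left_mono power_decreasing) auto
      finally show "norm (durfee_term q m (Suc k)) \<le> norm q ^ m * C * norm q ^ k"
        by (simp add: power_add mult_ac)
    next
      show "summable (\<lambda>k. norm (durfee_term q m (Suc k)))"
        by (subst summable_Suc_iff[of "\<lambda>k. norm (durfee_term q m k)"], rule durfee_summable_norm)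
      show "summable (\<lambda>k. norm q ^ m * C * norm q ^ k)"
        using q_less_1 by (intro summable_mult summable_geometric) simp
    qed
    also have "\<dots> = norm q ^ m * (C / (1 - norm q))"
      using q_less_1 by (subst suminf_mult) (simp_all add: suminf_geometric summable_geometric)
    finally show ?thesis .
  qed
  have "(\<lambda>m. norm q ^ m * (C / (1 - norm q))) \<longlonglongrightarrow> 0 * (C / (1 - norm q))"
    using q_less_1 by (intro tendsto_mult tendsto_const LIMSEQ_power_zero) simp
  then have "(\<lambda>m. G m - 1 / qpoch q q m) \<longlonglongrightarrow> 0"
    by (intro Lim_null_comparison[OF always_eventually[OF allI[OF G_limit]]]) simp
  moreover have "(\<lambda>m. 1 / qpoch q q m) \<longlonglongrightarrow> 1 / qpoch_inf q q"
    using qpoch_inf_nonzero[OF q_less_1 q_less_1] q_less_1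
    by (intro tendsto_divide tendsto_const qpoch_tendsto_qpoch_inf)
  ultimately have "(\<lambda>m. (G m - 1 / qpoch q q m) + 1 / qpoch q q m) \<longlonglongrightarrow> 0 + 1 / qpoch_inf q q"
    by (rule tendsto_add)
  then have G_tendsto: "G \<longlonglongrightarrow> 1 / qpoch_inf q q"
    by simp
  then have D_tendsto: "D \<longlonglongrightarrow> 1 / qpoch_inf q q - 1 / qpoch_inf q q"
    unfolding D_def by (intro tendsto_diff LIMSEQ_Suc)
  \<comment> \<open>A nondecreasing sequence of norms with limit 0 is identically 0, so no infinite
    product has to be extracted from the recurrence.\<close>
  have "norm (D m) \<le> norm (D (Suc m))" for m
  proof -
    have "norm (D m) = norm q ^ Suc m * norm (D (Suc m))"
      using \<open>D m = - (q ^ Suc m * D (Suc m))\<close> by (simp only: norm_mult norm_minus_cancel norm_power)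
    then show ?thesis
      using q_less_1 by (simp add: mult_left_le_one_le power_le_one del: power_Suc)
  qed
  then have "incseq (\<lambda>m. norm (D m))"
    by (rule incseq_SucI)
  moreover have "(\<lambda>m. norm (D m)) \<longlonglongrightarrow> 0"
    using tendsto_norm_zero[of D sequentially] D_tendsto by simp
  ultimately have "norm (D m) \<le> 0" for m
    by (rule incseq_le)
  then have "G (Suc m) = G m" for m
    by (simp add: D_def)
  then have "G = (\<lambda>_. G 0)"
    by (intro ext) (rule nat_induct, simp_all)
  then have "G m = 1 / qpoch_inf q q"
    using G_tendsto by (metis LIMSEQ_const_iff)
  then show ?thesis
    using S[of m] unfolding G_def by (simp add: sums_iff)
qed

lemma durfee_has_sum: "(durfee_term q m has_sum (1 / qpoch_inf q q)) UNIV"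
  by (rule norm_summable_imp_has_sum[OF durfee_summable_norm durfee_sums])

end

section \<open>The Jacobi triple product\<close>

lemma summable_on_product_nonneg:
  fixes f :: "'a \<Rightarrow> real" and g :: "'b \<Rightarrow> real"
  assumes "f summable_on A" "g summable_on B"
    and "\<And>x. x \<in> A \<Longrightarrow> f x \<ge> 0" "\<And>y. y \<in> B \<Longrightarrow> g y \<ge> 0"
  shows "(\<lambda>(x, y). f x * g y) summable_on A \<times> B"
proof (rule summable_on_SigmaI)
  show "((\<lambda>y. case (x, y) of (x, y) \<Rightarrow> f x * g y) has_sum f x * infsum g B) B" for x
    using assms(2) by (auto intro!: has_sum_cmult_right)
  show "(\<lambda>x. f x * infsum g B) summable_on A"
    using assms(1) by (intro summable_on_cmult_left)
qed (use assms(3,4) in auto)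

text \<open>Unconditional summability of complex families is absolute, which supplies the joint
  summability of the products.\<close>

lemma has_sum_product_complex:
  fixes f :: "'a \<Rightarrow> complex" and g :: "'b \<Rightarrow> complex"
  assumes "(f has_sum a) A" "(g has_sum b) B"
  shows "((\<lambda>(x, y). f x * g y) has_sum (a * b)) (A \<times> B)"
proof (rule has_sum_SigmaI)
  show "((\<lambda>y. case (x, y) of (x, y) \<Rightarrow> f x * g y) has_sum f x * b) B" for x
    using assms(2) by (auto intro!: has_sum_cmult_right)
  show "((\<lambda>x. f x * b) has_sum (a * b)) A"
    using assms(1) by (intro has_sum_cmult_left)
  have "(\<lambda>x. norm (f x)) summable_on A" "(\<lambda>y. norm (g y)) summable_on B"
    using assms has_sum_imp_summable summable_on_iff_abs_summable_on_complex by blast+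
  then have "(\<lambda>(x, y). norm (f x) * norm (g y)) summable_on A \<times> B"
    by (rule summable_on_product_nonneg) auto
  then have "(\<lambda>z. norm (case z of (x, y) \<Rightarrow> f x * g y)) summable_on A \<times> B"
    by (simp add: case_prod_unfold norm_mult)
  then show "(\<lambda>(x, y). f x * g y) summable_on A \<times> B"
    by (rule abs_summable_summable)
qed

lemma triangular_nat: "2 * (n * (n - 1) div 2) + n = n * (n :: nat)"
  by (cases n) (simp_all add: algebra_simps)

text \<open>In a product of two Euler series with indices k + n and k, this separates the part of
  the exponent depending on n alone from the exponent of \<open>durfee_term\<close>.\<close>

lemma triangular_add:
  "(k + n) * (k + n - 1) div 2 + k * (k - 1) div 2 + k = n * (n - 1) div 2 + (k * k + n * k :: nat)"
proof -
  define T where "T m = m * (m - 1) div 2" for m :: nat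
  have "2 * T m + m = m * m" for m
    unfolding T_def by (rule triangular_nat)
  from this[of "k + n"] this[of k] this[of n] have "T (k + n) + T k + k = T n + (k * k + n * k)"
    by (simp add: algebra_simps)
  then show ?thesis by (simp only: T_def)
qed

lemma triangular_int: "2 * (m * (m - 1) div 2) = m * (m - 1 :: int)"
  by simp

text \<open>Multiply the Euler series for z and q/z and collect the terms along the diagonals a - b
  = m. On each diagonal the terms are a theta term times the Durfee terms for |m|, whose sum
  1/(q;q)_inf is the same for all m.\<close>

theorem jacobi_triple_product:
  fixes q z :: complex
  assumes "norm q < 1" "q \<noteq> 0" "z \<noteq> 0"
  shows "((\<lambda>m::int. q powi (m * (m - 1) div 2) * z powi m)
           has_sum qpoch_inf (-z) q * qpoch_inf (-(q / z)) q * qpoch_inf q q) UNIV"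
proof -
  define P where "P = qpoch_inf (-z) q * qpoch_inf (-(q / z)) q"
  define t where "t m = q powi (m * (m - 1) div 2) * z powi m" for m :: int
  define E where "E = (\<lambda>(a, b). euler_coeff q a * z ^ a * (euler_coeff q b * (q / z) ^ b))"
  define F where "F = (\<lambda>(m, k). t m * durfee_term q (nat \<bar>m\<bar>) k)"
  have "(E has_sum P) (UNIV \<times> UNIV)"
    unfolding E_def P_def by (intro has_sum_product_complex euler_has_sum assms(1))
  also have "?this \<longleftrightarrow> (F has_sum P) (UNIV \<times> UNIV)"
  \<comment> \<open>A pair (a, b) is recorded by its diagonal a - b and its distance min a b from
    the boundary.\<close>
  proof (rule has_sum_reindex_bij_witness
      [where i = "\<lambda>(m, k). (k + nat m, k + nat (-m))" and j = "\<lambda>(a, b). (int a - int b, min a b)"])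
    have F_E: "F (m, k) = E (k + nat m, k + nat (-m))" for m k
    proof (cases "m \<ge> 0")
      case True
      then obtain n where m: "m = int n" by (metis nonneg_int_cases)
      have "int (n * (n - 1) div 2) = int n * (int n - 1) div 2"
      proof -
        have "2 * (int n * (int n - 1) div 2) = int n * int n - int n"
          unfolding triangular_int by (simp add: algebra_simps)
        moreover have "2 * int (n * (n - 1) div 2) + int n = int n * int n"
          using triangular_nat[of n] by (metis of_nat_add of_nat_mult of_nat_numeral)
        ultimately show ?thesis by simp
      qed
      then have t: "t m = q ^ (n * (n - 1) div 2) * z ^ n"
        unfolding t_def m by (metis power_int_of_nat)
      have "q ^ ((k + n) * (k + n - 1) div 2) * q ^ (k * (k - 1) div 2) * q ^ k
          = q ^ (n * (n - 1) div 2) * q ^ (k * k + n * k)"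
        by (metis power_add triangular_add)
      then show ?thesis
        using assms(3)
        by (simp add: F_def E_def t[unfolded m] euler_coeff_def durfee_term_def m
            power_add[of z] power_divide field_simps del: One_nat_def)
    next
      case False
      then obtain n where m: "m = - int n" by (metis int_cases2 of_nat_0_le_iff)
      have "int (n * (n - 1) div 2 + n) = - int n * (- int n - 1) div 2"
      proof -
        have "2 * (- int n * (- int n - 1) div 2) = int n * int n + int n"
          unfolding triangular_int by (simp add: algebra_simps)
        moreover have "2 * int (n * (n - 1) div 2) + int n = int n * int n"
          using triangular_nat[of n] by (metis of_nat_add of_nat_mult of_nat_numeral)
        ultimately show ?thesis by simp
      qed
      then have t: "t m = q ^ (n * (n - 1) div 2 + n) / z ^ n"
        unfolding t_def m by (metis power_int_of_nat power_int_minus divide_inverse)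
      have "(k + n) * (k + n - 1) div 2 + k * (k - 1) div 2 + (k + n)
          = (n * (n - 1) div 2 + n) + (k * k + n * k)"
        using triangular_add[of k n] by linarith
      then have "q ^ ((k + n) * (k + n - 1) div 2) * q ^ (k * (k - 1) div 2) * q ^ (k + n)
          = q ^ (n * (n - 1) div 2 + n) * q ^ (k * k + n * k)"
        by (metis power_add)
      then show ?thesis
        using assms(3)
        by (simp add: F_def E_def t[unfolded m] euler_coeff_def durfee_term_def m
            power_add[of z] power_divide field_simps del: One_nat_def)
    qed
    show "F (case a of (a, b) \<Rightarrow> (int a - int b, min a b)) = E a" for a
    proof (cases a)
      case (Pair x y)
      have "min x y + nat (int x - int y) = x" "min x y + nat (int y - int x) = y"
        by auto
      with Pair F_E[of "int x - int y" "min x y"] show ?thesis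
        by (simp only: prod.case minus_diff_eq)
    qed
  qed auto
  finally have FP: "(F has_sum P) (UNIV \<times> UNIV)" .
  have "((\<lambda>m. t m * (1 / qpoch_inf q q)) has_sum P) UNIV"
  proof (rule has_sum_Sigma'[OF FP])
    show "((\<lambda>k. F (m, k)) has_sum t m * (1 / qpoch_inf q q)) UNIV" for m
      unfolding F_def prod.case by (intro has_sum_cmult_right durfee_has_sum assms(1))
  qed
  from has_sum_cmult_left[OF this, of "qpoch_inf q q"] show ?thesis
    using qpoch_inf_nonzero[OF assms(1) assms(1)] by (simp add: t_def P_def mult_ac)
qed

text \<open>The triple product with base q^(2k) and z = -q^(k+c); then q^(2k)/z = -q^(k-c), where c
  < k keeps the exponent a genuine natural difference.\<close>

corollary theta_has_sum:
  fixes q :: complex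
  assumes "norm q < 1" "q \<noteq> 0" "c < k"
  shows "((\<lambda>m::int. (-1) powi m * q powi (int k * m ^ 2 + int c * m))
           has_sum qpoch_inf (q ^ (k + c)) (q ^ (2 * k)) * qpoch_inf (q ^ (k - c)) (q ^ (2 * k))
             * qpoch_inf (q ^ (2 * k)) (q ^ (2 * k))) UNIV"
proof -
  have "norm (q ^ (2 * k)) < 1"
    using assms by (simp add: norm_power power_less_one_iff)
  moreover have "q ^ (2 * k) \<noteq> 0" "- (q ^ (k + c)) \<noteq> 0"
    using assms(2) by auto
  moreover have "(q ^ (2 * k)) powi (m * (m - 1) div 2) * (- (q ^ (k + c))) powi m
      = (-1) powi m * q powi (int k * m ^ 2 + int c * m)" for m
  proof -
    have "(q ^ (2 * k)) powi (m * (m - 1) div 2) = q powi (int k * (2 * (m * (m - 1) div 2)))"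
    proof -
      have "q powi (int (2 * k) * (m * (m - 1) div 2)) = (q ^ (2 * k)) powi (m * (m - 1) div 2)"
        unfolding power_int_mult power_int_of_nat ..
      moreover have "int (2 * k) * (m * (m - 1) div 2) = int k * (2 * (m * (m - 1) div 2))"
        by simp
      ultimately show ?thesis by metis
    qed
    moreover have "(- (q ^ (k + c))) powi m = (-1) powi m * q powi (int (k + c) * m)"
      by (metis mult_minus1 power_int_mult power_int_mult_distrib power_int_of_nat)
    ultimately show ?thesis
      unfolding triangular_int using assms(2)
      by (simp add: power_int_add[symmetric] algebra_simps power2_eq_square)
  qed
  moreover have "q ^ (2 * k) / - (q ^ (k + c)) = - (q ^ (k - c))"
  proof -
    have "2 * k = (k - c) + (k + c)" using assms(3) by simp
    then have "q ^ (2 * k) = q ^ (k - c) * q ^ (k + c)" by (metis power_add)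
    then show ?thesis using assms(2) by simp
  qed
  ultimately show ?thesis
    using jacobi_triple_product[of "q ^ (2 * k)" "- (q ^ (k + c))"] by simp
qed

section \<open>Rogers' modulus 14 identities\<close>

lemma power_int_unit_bound:
  fixes q :: complex
  assumes "norm q < 1" "q \<noteq> 0" "m \<le> n"
  shows "norm (q powi n) \<le> norm q powi m"
  unfolding norm_power_int using assms by (intro power_int_decreasing) auto

text \<open>Formally over all integers, but finitely supported, since \<open>recip_qfact\<close>
  vanishes at negative arguments. Keeping a and b independent allows recurrences that lower only one
  of them.\<close>

definition bilateral :: "complex \<Rightarrow> (int \<Rightarrow> complex) \<Rightarrow> int \<Rightarrow> int \<Rightarrow> complex" where
  "bilateral q f a b = (\<Sum>\<^sub>\<infinity>s. f s * (recip_qfact q (a - 2 * s) * recip_qfact q (b + 2 * s)))"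

text \<open>The exponent is fitted to the factors q^(-2s) and q^(2s) of the Pascal relations: times
  q^(-2s) the weight is reflected to -s, and times q^(2s) it becomes (-1)^s q^(3s(s+1)), which is
  odd under s -> -1 - s.\<close>

definition rogers_weight :: "complex \<Rightarrow> int \<Rightarrow> complex" where
  "rogers_weight q s = (-1) powi s * q powi (3 * s ^ 2 + s)"

lemma neg_equal_zero_complex: "x = - x \<Longrightarrow> x = (0::complex)"
  by (metis add.left_inverse mult_2 mult_eq_0_iff zero_neq_numeral)

context
  fixes q :: complex
  assumes q_less_1: "norm q < 1" and q_nonzero: "q \<noteq> 0"
begin

section \<open>Bilateral sums: symmetries and q-Pascal relations\<close>

lemma bilateral_summable:
  "(\<lambda>s. f s * (recip_qfact q (a - 2 * s) * recip_qfact q (b + 2 * s))) summable_on UNIV"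
proof (rule finite_nonzero_values_imp_summable_on, rule finite_subset)
  show "{s \<in> UNIV. f s * (recip_qfact q (a - 2 * s) * recip_qfact q (b + 2 * s)) \<noteq> 0} \<subseteq> {-\<bar>b\<bar>..\<bar>a\<bar>}"
  proof
    fix s assume "s \<in> {s \<in> UNIV. f s * (recip_qfact q (a - 2 * s) * recip_qfact q (b + 2 * s)) \<noteq> 0}"
    then have "\<not> a - 2 * s < 0" "\<not> b + 2 * s < 0"
      using recip_qfact_neg by force+
    then show "s \<in> {-\<bar>b\<bar>..\<bar>a\<bar>}" by auto
  qed
qed simp

lemma bilateral_uminus: "bilateral q (\<lambda>s. - f s) a b = - bilateral q f a b"
  by (simp add: bilateral_def infsum_uminus)

lemma bilateral_reflect: "bilateral q f a b = bilateral q (\<lambda>s. f (-s)) b a"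
  unfolding bilateral_def
  by (rule infsum_reindex_bij_witness[where i = uminus and j = uminus]) (simp_all add: mult_ac)

text \<open>Needed because s -> -1 - s fixes every pair of the form (a - 1, a + 1).\<close>

lemma bilateral_shift: "bilateral q f a b = bilateral q (\<lambda>s. f (-1 - s)) (b - 2) (a + 2)"
  unfolding bilateral_def
  by (rule infsum_reindex_bij_witness[where i = "\<lambda>s. -1 - s" and j = "\<lambda>s. -1 - s"])
    (simp_all add: algebra_simps)

text \<open>Split 1 - q^(a+b) = (1 - q^(a-2s)) + q^(a-2s) (1 - q^(b+2s)); by
  \<open>recip_qfact_shift\<close> each bracket lowers one of the two q-factorials.\<close>

lemma bilateral_pascal:
  "(1 - q powi (a + b)) * bilateral q f a b
   = bilateral q f (a - 1) b + q powi a * bilateral q (\<lambda>s. q powi (-2 * s) * f s) a (b - 1)"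
proof -
  have "(1 - q powi (a + b)) * (f s * (recip_qfact q (a - 2 * s) * recip_qfact q (b + 2 * s)))
      = f s * (recip_qfact q (a - 1 - 2 * s) * recip_qfact q (b + 2 * s))
        + q powi a * (q powi (-2 * s) * f s * (recip_qfact q (a - 2 * s) * recip_qfact q (b - 1 + 2 * s)))" for s
  proof -
    have "q powi a * q powi (-2 * s) = q powi (a - 2 * s)"
      "q powi (a + b) = q powi (a - 2 * s) * q powi (b + 2 * s)"
      using q_nonzero by (simp_all flip: power_int_add)
    moreover have "recip_qfact q (a - 1 - 2 * s) = (1 - q powi (a - 2 * s)) * recip_qfact q (a - 2 * s)"
      "recip_qfact q (b - 1 + 2 * s) = (1 - q powi (b + 2 * s)) * recip_qfact q (b + 2 * s)"
      unfolding recip_qfact_shift[OF q_less_1] by (simp_all add: algebra_simps)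
    ultimately show ?thesis by (simp only: mult.assoc[symmetric]) (simp add: algebra_simps)
  qed
  then show ?thesis
    unfolding bilateral_def
    by (simp add: infsum_add bilateral_summable summable_on_cmult_right flip: infsum_cmult_right')
qed

lemma bilateral_pascal':
  "(1 - q powi (a + b)) * bilateral q f a b
   = bilateral q f a (b - 1) + q powi b * bilateral q (\<lambda>s. q powi (2 * s) * f s) (a - 1) b"
proof -
  have "(1 - q powi (b + a)) * bilateral q (\<lambda>s. f (-s)) b a
    = bilateral q (\<lambda>s. f (-s)) (b - 1) a + q powi b * bilateral q (\<lambda>s. q powi (-2 * s) * f (-s)) b (a - 1)"
    by (rule bilateral_pascal)
  then show ?thesis
    using bilateral_reflect[of f a b] bilateral_reflect[of f a "b - 1"]
      bilateral_reflect[of "\<lambda>s. q powi (2 * s) * f s" "a - 1" b]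
    by (simp add: add.commute)
qed

section \<open>Closed forms for the Rogers weight\<close>

lemma rogers_weight_neg:
  "(\<lambda>s. q powi (-2 * s) * rogers_weight q s) = (\<lambda>s. rogers_weight q (-s))"
proof
  fix s :: int
  have "(-1 :: complex) powi (-s) = (-1) powi s"
    by (simp add: power_int_minus power_int_minus_left)
  moreover have "q powi (-2 * s) * q powi (3 * s ^ 2 + s) = q powi (3 * (-s) ^ 2 + (-s))"
    using q_nonzero by (simp flip: power_int_add)
  ultimately show "q powi (-2 * s) * rogers_weight q s = rogers_weight q (-s)"
    unfolding rogers_weight_def by (metis mult.left_commute)
qed

lemma rogers_weight_antisym:
  "(\<lambda>s. q powi (2 * (-1 - s)) * rogers_weight q (-1 - s)) = (\<lambda>s. - (q powi (2 * s) * rogers_weight q s))"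
proof
  fix s :: int
  have "(-1 :: complex) powi (-1 - s) = - ((-1) powi s)"
    by (simp add: power_int_minus_left)
  moreover have "q powi (2 * (-1 - s)) * q powi (3 * (-1 - s) ^ 2 + (-1 - s))
      = q powi (2 * s) * q powi (3 * s ^ 2 + s)"
  proof -
    have "2 * (-1 - s) + (3 * (-1 - s) ^ 2 + (-1 - s)) = 2 * s + (3 * s ^ 2 + s)"
      by (simp add: algebra_simps power2_eq_square)
    then show ?thesis
      using q_nonzero by (metis power_int_add)
  qed
  ultimately show "q powi (2 * (-1 - s)) * rogers_weight q (-1 - s) = - (q powi (2 * s) * rogers_weight q s)"
    unfolding rogers_weight_def by (metis mult.left_commute mult_minus_left)
qed

lemma bilateral_rogers_reflect:
  "bilateral q (\<lambda>s. rogers_weight q (-s)) b a = bilateral q (rogers_weight q) a b"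
  by (rule bilateral_reflect[symmetric])

text \<open>The weight is odd under s -> -1 - s while the pair of q-factorials is preserved, so the
  sum equals its own negative.\<close>

lemma bilateral_rogers_vanish:
  "bilateral q (\<lambda>s. q powi (2 * s) * rogers_weight q s) (a - 1) (a + 1) = 0"
proof -
  have "bilateral q (\<lambda>s. q powi (2 * s) * rogers_weight q s) (a - 1) (a + 1)
      = - bilateral q (\<lambda>s. q powi (2 * s) * rogers_weight q s) (a + 1 - 2) (a - 1 + 2)"
    using bilateral_shift[of "\<lambda>s. q powi (2 * s) * rogers_weight q s" "a - 1" "a + 1"]
    unfolding rogers_weight_antisym bilateral_uminus .
  moreover have "a + 1 - 2 = a - 1" "a - 1 + 2 = a + 1"
    by simp_all
  ultimately show ?thesis by (metis neg_equal_zero_complex)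
qed

lemma bilateral_rogers_odd:
  "(1 - q powi (2 * a + 1)) * bilateral q (rogers_weight q) a (a + 1) = bilateral q (rogers_weight q) a a"
proof -
  have eq: "a + (a + 1) = 2 * a + 1" by simp
  show ?thesis
    using bilateral_pascal'[of a "a + 1" "rogers_weight q"] unfolding bilateral_rogers_vanish eq by simp
qed

text \<open>On the diagonal the two terms of \<open>bilateral_pascal\<close> coincide after
  reflection, whence the factor 1 + q^(a+1).\<close>

lemma bilateral_rogers_even:
  "(1 - q powi (2 * a + 2)) * bilateral q (rogers_weight q) (a + 1) (a + 1)
   = (1 + q powi (a + 1)) * bilateral q (rogers_weight q) a (a + 1)"
proof -
  have eq: "a + 1 + (a + 1) = 2 * a + 2" "a + 1 - 1 = a" by simp_all
  show ?thesis
    using bilateral_pascal[of "a + 1" "a + 1" "rogers_weight q"]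
    unfolding rogers_weight_neg bilateral_rogers_reflect eq by (simp only: distrib_right mult_1_left)
qed

text \<open>This reaches the off-diagonal b - a = 2: apply \<open>bilateral_pascal\<close> at (a +
  1, a + 2) and evaluate its left side by \<open>bilateral_rogers_odd\<close>.\<close>

lemma bilateral_rogers_even':
  "bilateral q (rogers_weight q) a (a + 2) = (1 - q powi (a + 1)) * bilateral q (rogers_weight q) (a + 1) (a + 1)"
proof -
  have eq: "a + 1 + (a + 2) = 2 * (a + 1) + 1" "a + 1 - 1 = a" "a + 2 - 1 = a + 1" "a + 1 + 1 = a + 2"
    by simp_all
  have "bilateral q (rogers_weight q) (a + 1) (a + 1)
      = bilateral q (rogers_weight q) a (a + 2) + q powi (a + 1) * bilateral q (rogers_weight q) (a + 1) (a + 1)"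
    using bilateral_pascal[of "a + 1" "a + 2" "rogers_weight q"] bilateral_rogers_odd[of "a + 1"]
    unfolding rogers_weight_neg bilateral_rogers_reflect eq by (rule trans[OF sym, rotated])
  then show ?thesis
    by (simp add: left_diff_distrib eq_diff_eq)
qed

text \<open>The step from n to n + 1 passes through (n, n + 1): the odd relation contributes 1/(1 -
  q^(2n+1)), the even one (1 + q^(n+1))/(1 - q^(2n+2)).\<close>

lemma bilateral_rogers_0:
  "bilateral q (rogers_weight q) (int n) (int n) = qpoch (-q) q n / qpoch q q (2 * n)"
proof (induction n)
  case 0
  have "rogers_weight q s * (recip_qfact q (0 - 2 * s) * recip_qfact q (0 + 2 * s)) = 0" if "s \<noteq> 0" for s
    using that by (cases "s > 0") simp_all
  then have "bilateral q (rogers_weight q) 0 0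
      = (\<Sum>\<^sub>\<infinity>s\<in>{0}. rogers_weight q s * (recip_qfact q (0 - 2 * s) * recip_qfact q (0 + 2 * s)))"
    unfolding bilateral_def by (intro infsum_cong_neutral) auto
  moreover have "rogers_weight q 0 = 1"
    by (simp add: rogers_weight_def)
  ultimately show ?case by (simp add: recip_qfact_def)
next
  case (Suc n)
  have nz: "1 - q * q ^ (2 * n) \<noteq> 0" "1 - q * (q * q ^ (2 * n)) \<noteq> 0"
    using one_minus_power_nonzero[OF q_less_1, of "Suc (2 * n)"]
      one_minus_power_nonzero[OF q_less_1, of "Suc (Suc (2 * n))"] by simp_all
  have "q powi (2 * int n + 1) = q * q ^ (2 * n)" "q powi (2 * int n + 2) = q * (q * q ^ (2 * n))"
    "q powi (int n + 1) = q * q ^ n"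
    using power_int_of_nat[of q "Suc (2 * n)"] power_int_of_nat[of q "Suc (Suc (2 * n))"]
      power_int_of_nat[of q "Suc n"] by (simp_all add: algebra_simps)
  then have "bilateral q (rogers_weight q) (int n) (int n + 1)
      = bilateral q (rogers_weight q) (int n) (int n) / (1 - q * q ^ (2 * n))"
    "bilateral q (rogers_weight q) (int n + 1) (int n + 1)
      = (1 + q * q ^ n) * bilateral q (rogers_weight q) (int n) (int n + 1) / (1 - q * (q * q ^ (2 * n)))"
    using bilateral_rogers_odd[of "int n"] bilateral_rogers_even[of "int n"] nz
    by (simp_all add: eq_divide_eq mult.commute)
  moreover have "int (Suc n) = int n + 1"
    by simp
  ultimately show ?case
    by (simp only: Suc) (simp add: qpoch_qq_Suc qpoch_Suc mult_ac)
qed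

lemma bilateral_rogers_1:
  "bilateral q (rogers_weight q) (int n) (int n + 1) = qpoch (-q) q n / qpoch q q (2 * n + 1)"
proof -
  have "q powi (2 * int n + 1) = q ^ Suc (2 * n)"
    using power_int_of_nat[of q "Suc (2 * n)"] by (simp add: algebra_simps)
  then show ?thesis
    using bilateral_rogers_odd[of "int n"] bilateral_rogers_0[of n]
      one_minus_power_nonzero[OF q_less_1, of "Suc (2 * n)"] qpoch_qq_nonzero[OF q_less_1, of "2 * n"]
    by (simp add: qpoch_qq_Suc field_simps)
qed

lemma bilateral_rogers_2:
  "bilateral q (rogers_weight q) (int n) (int n + 2) = qpoch (-q) q n / qpoch q q (2 * n + 1)"
proof -
  have "q powi (int n + 1) = q ^ Suc n"
    using power_int_of_nat[of q "Suc n"] by (simp add: algebra_simps)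
  moreover have "int (Suc n) = int n + 1"
    by simp
  ultimately have "bilateral q (rogers_weight q) (int n) (int n + 2)
      = (1 - q ^ Suc n) * (qpoch (-q) q (Suc n) / qpoch q q (2 * Suc n))"
    using bilateral_rogers_even'[of "int n"] bilateral_rogers_0[of "Suc n"] by metis
  also have "\<dots> = (1 - q ^ Suc n) * qpoch (-q) q (Suc n) / qpoch q q (2 * Suc n)"
    by simp
  \<comment> \<open>(1 - q^(n+1)) (1 + q^(n+1)) cancels the last factor of (q;q)_(2n+2). The value
    thus agrees with \<open>bilateral_rogers_1\<close>, which is why d = 1 and d = 2 share the same
    denominator.\<close>
  also have "(1 - q ^ Suc n) * qpoch (-q) q (Suc n) = qpoch (-q) q n * (1 - q ^ Suc (Suc (2 * n)))"
    by (simp add: qpoch_Suc algebra_simps mult_2_right power_add mult_2)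
  also have "qpoch q q (2 * Suc n) = qpoch q q (2 * n + 1) * (1 - q ^ Suc (Suc (2 * n)))"
    using qpoch_qq_Suc[of q "Suc (2 * n)"] by simp
  finally show ?thesis
    using one_minus_power_nonzero[OF q_less_1, of "Suc (Suc (2 * n))"] by simp
qed

section \<open>Summation over n and the modulus 14\<close>

lemma durfee_shift_has_sum:
  "((\<lambda>n. q ^ (n * n + d * n) * (recip_qfact q (int n - int t) * recip_qfact q (int n + int d + int t)))
     has_sum q ^ (t * t + d * t) * (1 / qpoch_inf q q)) UNIV"
proof -
  define f where
    "f n = q ^ (n * n + d * n) * (recip_qfact q (int n - int t) * recip_qfact q (int n + int d + int t))" for n
  \<comment> \<open>The summand vanishes for n < t, so the series really starts at n = t, and the
    two q-factorials then differ in index by 2t + d.\<close>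
  have "f (t + k) = q ^ (t * t + d * t) * durfee_term q (2 * t + d) k" for k
  proof -
    have "recip_qfact q (int (t + k) - int t) = 1 / qpoch q q k"
      "recip_qfact q (int (t + k) + int d + int t) = 1 / qpoch q q (k + (2 * t + d))"
      using recip_qfact_of_nat[of q "k"] recip_qfact_of_nat[of q "k + (2 * t + d)"]
      by (simp_all add: algebra_simps)
    moreover have "(t + k) * (t + k) + d * (t + k) = (t * t + d * t) + (k * k + (2 * t + d) * k)"
      by (simp add: algebra_simps)
    ultimately show ?thesis
      by (simp only: f_def durfee_term_def power_add) simp
  qed
  then have "((f \<circ> (\<lambda>k. t + k)) has_sum q ^ (t * t + d * t) * (1 / qpoch_inf q q)) UNIV"
    unfolding o_def by (simp only:) (intro has_sum_cmult_right durfee_has_sum q_less_1)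
  then have "(f has_sum q ^ (t * t + d * t) * (1 / qpoch_inf q q)) (range (\<lambda>k. t + k))"
    by (subst has_sum_reindex) auto
  also have "?this \<longleftrightarrow> (f has_sum q ^ (t * t + d * t) * (1 / qpoch_inf q q)) UNIV"
  proof (rule has_sum_cong_neutral)
    fix n assume "n \<in> UNIV - range (\<lambda>k. t + k)"
    then have "n < t"
      by (metis DiffD2 le_iff_add not_less rangeI)
    then show "f n = 0"
      by (simp add: f_def)
  qed auto
  finally show ?thesis
    unfolding f_def .
qed

text \<open>The map r -> -d - r swaps the two factors and preserves r^2 + d r, which reduces
  negative r to the shifted case. Strictly between -d and 0 some negative n would also contribute,
  and the sum over natural n would miss them.\<close>

lemma durfee_bilateral_has_sum:
  assumes "r \<ge> 0 \<or> r \<le> - int d"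
  shows "((\<lambda>n. q ^ (n * n + d * n) * (recip_qfact q (int n - r) * recip_qfact q (int n + int d + r)))
     has_sum q powi (r ^ 2 + int d * r) * (1 / qpoch_inf q q)) UNIV"
proof (cases "r \<ge> 0")
  case True
  then obtain t where r: "r = int t"
    by (metis nonneg_int_cases)
  have "q powi (r ^ 2 + int d * r) = q ^ (t * t + d * t)"
    unfolding r power2_eq_square by (simp flip: power_int_of_nat)
  then show ?thesis
    using durfee_shift_has_sum[of d t] unfolding r by simp
next
  case False
  define t where "t = nat (- r - int d)"
  have r: "r = - int d - int t"
    using False assms by (simp add: t_def)
  have "r ^ 2 + int d * r = int (t * t + d * t)"
    unfolding r by (simp add: power2_eq_square algebra_simps)
  then have "q powi (r ^ 2 + int d * r) = q ^ (t * t + d * t)"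
    by (metis power_int_of_nat)
  moreover have "int n - r = int n + int d + int t" "int n + int d + r = int n - int t" for n
    unfolding r by simp_all
  ultimately show ?thesis
    using durfee_shift_has_sum[of d t] by (simp only:) (simp only: mult_ac)
qed

lemma geometric_int_summable: "(\<lambda>s::int. norm q ^ nat \<bar>s\<bar>) summable_on UNIV"
proof -
  have geo: "(\<lambda>n. norm q ^ n) summable_on UNIV"
    using q_less_1 by (intro norm_summable_imp_summable_on) (simp add: summable_geometric)
  have "(\<lambda>s::int. norm q ^ nat \<bar>s\<bar>) summable_on range int"
    by (subst summable_on_reindex) (use geo in \<open>simp_all add: o_def\<close>)
  moreover have "(\<lambda>s::int. norm q ^ nat \<bar>s\<bar>) summable_on range (\<lambda>n. - int n)"
    by (subst summable_on_reindex) (use geo in \<open>simp_all add: o_def inj_def\<close>)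
  ultimately have "(\<lambda>s::int. norm q ^ nat \<bar>s\<bar>) summable_on range int \<union> range (\<lambda>n. - int n)"
    by (rule summable_on_union)
  moreover have "range int \<union> range (\<lambda>n. - int n) = UNIV"
    by (metis (no_types, lifting) UNIV_eq_I UnI1 UnI2 int_cases2 rangeI)
  ultimately show ?thesis by simp
qed

text \<open>One double series over (s, n), dominated by a multiple of |q|^|s| |q|^n. Summing over n
  first leaves a theta series; summing over s first gives the bilateral sums.\<close>

theorem rogers_bailey_has_sum:
  assumes "d \<le> 2"
  shows "((\<lambda>n. q ^ (n * n + d * n) * bilateral q (rogers_weight q) (int n) (int n + int d))
     has_sum qpoch_inf (q ^ (8 + 2 * d)) (q ^ 14) * qpoch_inf (q ^ (6 - 2 * d)) (q ^ 14)
       * qpoch_inf (q ^ 14) (q ^ 14) / qpoch_inf q q) UNIV"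
proof -
  define w where "w n s = recip_qfact q (int n - 2 * s) * recip_qfact q (int n + int d + 2 * s)" for n s
  define F where "F = (\<lambda>(s, n). rogers_weight q s * (q ^ (n * n + d * n) * w n s))"
  define T where "T = qpoch_inf (q ^ (8 + 2 * d)) (q ^ 14) * qpoch_inf (q ^ (6 - 2 * d)) (q ^ 14)
       * qpoch_inf (q ^ 14) (q ^ 14)"
  have inner: "((\<lambda>n. F (s, n)) has_sum
      (-1) powi s * q powi (int 7 * s ^ 2 + int (2 * d + 1) * s) * (1 / qpoch_inf q q)) UNIV" for s
  proof -
    have "q powi (3 * s ^ 2 + s) * q powi ((2 * s) ^ 2 + int d * (2 * s))
        = q powi (int 7 * s ^ 2 + int (2 * d + 1) * s)"
    proof -
      have "(3 * s ^ 2 + s) + ((2 * s) ^ 2 + int d * (2 * s)) = int 7 * s ^ 2 + int (2 * d + 1) * s"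
        by (simp add: algebra_simps power2_eq_square)
      then show ?thesis
        using q_nonzero by (metis power_int_add)
    qed
    then have rw: "rogers_weight q s * (q powi ((2 * s) ^ 2 + int d * (2 * s)) * (1 / qpoch_inf q q))
        = (-1) powi s * q powi (int 7 * s ^ 2 + int (2 * d + 1) * s) * (1 / qpoch_inf q q)"
      unfolding rogers_weight_def by (metis mult.assoc)
    \<comment> \<open>An even number strictly between -d and 0 would require d >= 3.\<close>
    have "2 * s \<ge> 0 \<or> 2 * s \<le> - int d"
      using assms by arith
    from has_sum_cmult_right[OF durfee_bilateral_has_sum[OF this], of "rogers_weight q s"]
    show ?thesis
      unfolding rw by (simp add: F_def w_def)
  qed
  have outer: "((\<lambda>s. (-1) powi s * q powi (int 7 * s ^ 2 + int (2 * d + 1) * s) * (1 / qpoch_inf q q))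
      has_sum T * (1 / qpoch_inf q q)) UNIV"
  proof -
    \<comment> \<open>\<open>theta_has_sum\<close> with k = 7 and c = 2d + 1, where c < 7 holds
      because d <= 2.\<close>
    have "7 + (2 * d + 1) = 8 + 2 * d" "7 - (2 * d + 1) = 6 - 2 * d" "2 * 7 = (14 :: nat)"
      by simp_all
    then show ?thesis
      using theta_has_sum[OF q_less_1 q_nonzero, of "2 * d + 1" 7] assms
      by (intro has_sum_cmult_left) (simp only: T_def)
  qed
  have "F summable_on UNIV \<times> UNIV"
  proof -
    obtain C where C: "C > 0" "\<And>n. norm (recip_qfact q n) \<le> C"
      using recip_qfact_bounded[OF q_less_1] by blast
    have geo: "(\<lambda>n. C * C * norm q ^ n) summable_on UNIV"
      using q_less_1 by (intro summable_on_cmult_right norm_summable_imp_summable_on) (simp add: summable_geometric)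
    have "(\<lambda>(s::int, n). norm q ^ nat \<bar>s\<bar> * (C * C * norm q ^ n)) summable_on UNIV \<times> UNIV"
      using C(1) by (intro summable_on_product_nonneg geometric_int_summable geo) auto
    then have "(\<lambda>x. norm (F x)) summable_on UNIV \<times> UNIV"
    proof (rule Infinite_Sum.abs_summable_on_comparison_test')
      fix x :: "int \<times> nat"
      obtain s n where x: "x = (s, n)" by force
      have "norm (rogers_weight q s) \<le> norm q ^ nat \<bar>s\<bar>"
      proof -
        have "\<bar>s\<bar> \<le> 3 * s ^ 2 + s"
        proof (cases "s \<ge> 0")
          case False
          then have "s * s \<ge> - s"
            using mult_right_mono_neg[of s "-1" s] by simp
          then show ?thesis using False by (simp add: power2_eq_square)
        qed simp
        from power_int_unit_bound[OF q_less_1 q_nonzero this] show ?thesis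
          by (simp add: rogers_weight_def norm_mult norm_power_int
              flip: power_int_of_nat)
      qed
      moreover have "norm (w n s) \<le> C * C"
        unfolding w_def norm_mult using C by (intro mult_mono) (auto intro: less_imp_le)
      moreover have "norm (q ^ (n * n + d * n)) \<le> norm q ^ n"
        unfolding norm_power using q_less_1 by (intro power_decreasing) (cases n, auto)
      ultimately have "norm (F x) \<le> norm q ^ nat \<bar>s\<bar> * (norm q ^ n * (C * C))"
        unfolding x F_def prod.case norm_mult[of "rogers_weight q s"] norm_mult[of "q ^ (n * n + d * n)"]
        using C(1) by (intro mult_mono) auto
      then show "norm (F x) \<le> (case x of (s, n) \<Rightarrow> norm q ^ nat \<bar>s\<bar> * (C * C * norm q ^ n))"
        by (simp add: x mult_ac)
    qed
    then show ?thesis by (rule abs_summable_summable)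
  qed
  from has_sum_SigmaI[OF inner outer this] have "(F has_sum T * (1 / qpoch_inf q q)) (UNIV \<times> UNIV)"
    by simp
  then have F: "((\<lambda>(n, s). F (s, n)) has_sum T * (1 / qpoch_inf q q)) (UNIV \<times> UNIV)"
    by (subst (asm) has_sum_swap)
  have "((\<lambda>n. q ^ (n * n + d * n) * bilateral q (rogers_weight q) (int n) (int n + int d))
      has_sum T * (1 / qpoch_inf q q)) UNIV"
  proof (rule has_sum_Sigma'[OF F])
    fix n :: nat
    have "((\<lambda>s. rogers_weight q s * w n s) has_sum
        bilateral q (rogers_weight q) (int n) (int n + int d)) UNIV"
      unfolding w_def bilateral_def
      by (rule has_sum_infsum, rule bilateral_summable)
    from has_sum_cmult_right[OF this, of "q ^ (n * n + d * n)"]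
    show "((\<lambda>s. case (n, s) of (n, s) \<Rightarrow> F (s, n)) has_sum
        q ^ (n * n + d * n) * bilateral q (rogers_weight q) (int n) (int n + int d)) UNIV"
      by (simp add: F_def mult_ac)
  qed
  then show ?thesis
    by (simp add: T_def)
qed

section \<open>The inner sums\<close>

text \<open>The 2 is the first factor of (-1;q)_inf. Each further i prepends 1 + q^(-i) = q^(-i) (1
  + q^i), and the powers of q accumulate to a triangular exponent.\<close>

lemma qpoch_inf_minus_inverse_power:
  "qpoch_inf (- ((1 / q) ^ i)) q = 2 * (qpoch (-q) q i * qpoch_inf (-q) q / q ^ (i * (i + 1) div 2))"
proof (induction i)
  case 0
  show ?case
    using qpoch_inf_split[OF q_less_1, of "-1" 1] by (simp add: qpoch_Suc)
next
  case (Suc i)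
  have "qpoch_inf (- ((1 / q) ^ Suc i)) q = (1 + (1 / q) ^ Suc i) * qpoch_inf (- ((1 / q) ^ i)) q"
    using qpoch_inf_split[OF q_less_1, of "- ((1 / q) ^ Suc i)" 1] q_nonzero
    by (simp add: qpoch_Suc)
  moreover have "Suc i * (Suc i + 1) div 2 = Suc i + i * (i + 1) div 2"
    by simp
  moreover have "1 + (1 / q) ^ Suc i = (1 + q ^ Suc i) / q ^ Suc i"
    using q_nonzero by (simp add: divide_simps del: power_Suc)
  ultimately show ?case
    unfolding Suc by (simp add: qpoch_Suc power_add mult_ac)
qed

text \<open>Euler's product vanishes at \<open>-q\<^bsup>-i\<^esup>\<close>, so the even and the odd part of Euler's series
  at \<open>q\<^bsup>-i\<^esup>\<close> coincide.\<close>

lemma euler_parity_has_sum: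
  assumes "p < 2"
  shows "((\<lambda>j. euler_coeff q (2 * j + p) * ((1 / q) ^ i) ^ (2 * j + p))
     has_sum qpoch (-q) q i * qpoch_inf (-q) q / q ^ (i * (i + 1) div 2)) UNIV"
proof -
  define z where "z = (1 / q) ^ i"
  define S where "S = qpoch (-q) q i * qpoch_inf (-q) q / q ^ (i * (i + 1) div 2)"
  have "z * q ^ i = 1"
    using q_nonzero by (simp add: z_def power_divide)
  then have "((\<lambda>n. euler_coeff q n * (-z) ^ n) has_sum 0) UNIV"
    using euler_has_sum[OF q_less_1, of "-z"] qpoch_inf_eq_0[OF q_less_1, of z i] by simp
  then have 1: "((\<lambda>n. (-1) ^ p / 2 * (euler_coeff q n * (-z) ^ n)) has_sum (-1) ^ p / 2 * 0) UNIV"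
    by (rule has_sum_cmult_right)
  have "((\<lambda>n. euler_coeff q n * z ^ n) has_sum 2 * S) UNIV"
    using euler_has_sum[OF q_less_1, of z] qpoch_inf_minus_inverse_power[of i] by (simp add: z_def S_def)
  then have 2: "((\<lambda>n. 1 / 2 * (euler_coeff q n * z ^ n)) has_sum 1 / 2 * (2 * S)) UNIV"
    by (rule has_sum_cmult_right)
  \<comment> \<open>Projection onto the indices of the parity of p; the series at -z has sum 0, so
    both parities receive half of the series at z.\<close>
  define f where "f n = 1 / 2 * (euler_coeff q n * z ^ n) + (-1) ^ p / 2 * (euler_coeff q n * (-z) ^ n)" for n
  have f: "f n = (1 + (-1) ^ (p + n)) / 2 * (euler_coeff q n * z ^ n)" for n
    unfolding f_def by (simp add: power_add power_minus[of z] algebra_simps add_divide_distrib)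
  have "1 / 2 * (2 * S) + (-1) ^ p / 2 * 0 = S"
    by simp
  then have "(f has_sum S) UNIV"
    using has_sum_add[OF 2 1] unfolding f_def by (simp only:)
  also have "?this \<longleftrightarrow> (f has_sum S) (range (\<lambda>j. 2 * j + p))"
  proof (rule has_sum_cong_neutral[symmetric])
    fix n assume n: "n \<in> UNIV - range (\<lambda>j. 2 * j + p)"
    have "odd (p + n)"
    proof
      assume "even (p + n)"
      then have "n mod 2 = p"
        using assms by presburger
      then have "n = 2 * (n div 2) + p"
        by (metis mult_div_mod_eq)
      with n show False by blast
    qed
    then show "f n = 0" by (simp add: f)
  qed auto
  also have "\<dots> \<longleftrightarrow> ((f \<circ> (\<lambda>j. 2 * j + p)) has_sum S) UNIV"
    by (rule has_sum_reindex) (simp add: inj_def)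
  also have "f \<circ> (\<lambda>j. 2 * j + p) = (\<lambda>j. euler_coeff q (2 * j + p) * z ^ (2 * j + p))"
  proof
    fix j
    have "(-1 :: complex) ^ (p + (2 * j + p)) = 1"
      by simp
    then show "(f \<circ> (\<lambda>j. 2 * j + p)) j = euler_coeff q (2 * j + p) * z ^ (2 * j + p)"
      unfolding o_def f by simp
  qed
  finally show ?thesis
    unfolding z_def S_def .
qed

end

section \<open>Reduction of the double sums\<close>

text \<open>Collected from four sources: the Rogers sum (i^2 + d i), the factor q^(i(i+1)/2) that
  clears the denominator of the inner sum, Euler's coefficient at 2j + p, and the argument q^(-i).
  Triangular numbers keep every summand integral.\<close>

definition double_exponent :: "nat \<Rightarrow> nat \<Rightarrow> nat \<Rightarrow> nat \<Rightarrow> int" where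
  "double_exponent d p i j = int i * int i + int d * int i + int (i * (i + 1) div 2)
     + int ((2 * j + p) * (2 * j + p - 1) div 2) - int i * int (2 * j + p)"

lemma double_exponent_twice:
  "2 * double_exponent d p i j = 3 * int i ^ 2 + (2 * int d + 1) * int i
     + int (2 * j + p) ^ 2 - int (2 * j + p) - 2 * int i * int (2 * j + p)"
proof -
  have "2 * int (i * (i + 1) div 2) = int i * (int i + 1)"
  proof -
    have "2 * (i * (i + 1) div 2) = i * (i + 1)"
      by simp
    from arg_cong[OF this, of int] show ?thesis
      by (simp only: of_nat_mult of_nat_add of_nat_numeral of_nat_1)
  qed
  moreover have "2 * int (m * (m - 1) div 2) = int m ^ 2 - int m" for m
    using arg_cong[OF triangular_nat[of m], of int]
    by (simp only: of_nat_mult of_nat_add of_nat_numeral power2_eq_square eq_diff_eq)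
  ultimately have "2 * int (i * (i + 1) div 2) + 2 * int ((2 * j + p) * (2 * j + p - 1) div 2)
      = int i * (int i + 1) + int (2 * j + p) ^ 2 - int (2 * j + p)"
    by (simp only: add_diff_eq)
  moreover have "2 * (a + b + x + y - c) = 2 * a + 2 * b + (2 * x + 2 * y) - 2 * c" for a b c x y :: int
    by simp
  ultimately show ?thesis
    unfolding double_exponent_def by (simp only:) (simp add: algebra_simps power2_eq_square)
qed

lemma double_exponent_ge: "double_exponent d p i j \<ge> int i + int j - 1"
proof -
  define m where "m = int (2 * j + p)"
  \<comment> \<open>Integrality matters: the product is negative for real i between 1/2 and 1.
    Together with the square below it completes the quadratic form.\<close>
  have "(2 * int i - 1) * (int i - 1) \<ge> 0"
    by (cases "i = 0") auto
  then have "(m - int i - 1) ^ 2 + (2 * int i - 1) * (int i - 1) \<ge> 0"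
    by simp
  then have "2 * int i + m - 2 \<le> 3 * int i ^ 2 + int i + m ^ 2 - m - 2 * int i * m"
    by (simp add: algebra_simps power2_eq_square)
  also have "\<dots> \<le> 2 * double_exponent d p i j"
    unfolding double_exponent_twice m_def by (simp add: algebra_simps)
  finally show ?thesis
    by (simp add: m_def)
qed

text \<open>Serves q = 0, where only exponent 0 contributes. The linear lower bound leaves just the
  indices with i + j <= 1 to inspect.\<close>

lemma double_exponent_eq_0_iff:
  assumes "p < 2"
  shows "double_exponent d p i j = 0 \<longleftrightarrow> i = 0 \<and> j = 0"
proof
  assume z: "double_exponent d p i j = 0"
  have "i + j \<le> 1"
    using double_exponent_ge[of i j d p] z by linarith
  then consider "i = 0" "j = 0" | "i = 0" "j = 1" | "i = 1" "j = 0"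
    by linarith
  moreover have "p = 0 \<or> p = 1"
    using assms by linarith
  ultimately show "i = 0 \<and> j = 0"
    using z by cases (auto simp: double_exponent_def)
next
  have "p = 0 \<or> p = 1"
    using assms by linarith
  then show "i = 0 \<and> j = 0 \<Longrightarrow> double_exponent d p i j = 0"
    by (auto simp: double_exponent_def)
qed

lemma double_exponent_summable:
  fixes q :: complex
  assumes "norm q < 1" "q \<noteq> 0"
  shows "(\<lambda>(i, j). q powi double_exponent d p i j / (qpoch q q (2 * i + e) * qpoch q q (2 * j + p)))
    summable_on UNIV \<times> UNIV"
proof -
  obtain C where C: "C > 0" "\<And>n. norm (recip_qfact q n) \<le> C"
    using recip_qfact_bounded[OF assms(1)] by blast
  have geo: "(\<lambda>n. norm q ^ n) summable_on UNIV"
    using assms by (intro norm_summable_imp_summable_on) (simp add: summable_geometric)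
  \<comment> \<open>The division by |q| accounts for the -1 in
    \<open>double_exponent_ge\<close>.\<close>
  have "(\<lambda>(i, j). (C * C / norm q * norm q ^ i) * norm q ^ j) summable_on UNIV \<times> UNIV"
    using C(1) by (intro summable_on_product_nonneg summable_on_cmult_right geo) auto
  then have "(\<lambda>x. norm (case x of (i, j) \<Rightarrow>
      q powi double_exponent d p i j / (qpoch q q (2 * i + e) * qpoch q q (2 * j + p))))
      summable_on UNIV \<times> UNIV"
  proof (rule Infinite_Sum.abs_summable_on_comparison_test')
    fix x :: "nat \<times> nat"
    obtain i j where x: "x = (i, j)" by force
    have "norm (q powi double_exponent d p i j) \<le> norm q powi (int (i + j) - 1)"
      by (rule power_int_unit_bound[OF assms]) (use double_exponent_ge[of i j d p] in simp)
    also have "\<dots> = norm q ^ i * norm q ^ j / norm q"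
      using assms(2) power_int_diff[of "norm q" "int (i + j)" 1]
      by (simp only: power_int_of_nat power_int_1_right power_add) simp
    finally have 1: "norm (q powi double_exponent d p i j) \<le> norm q ^ i * norm q ^ j / norm q" .
    have "norm (1 / qpoch q q n) \<le> C" for n
      using C(2)[of "int n"] by (simp only: recip_qfact_of_nat)
    then have 2: "norm (1 / qpoch q q (2 * i + e)) * norm (1 / qpoch q q (2 * j + p)) \<le> C * C"
      using C(1) by (intro mult_mono) auto
    have "norm (q powi double_exponent d p i j)
        * (norm (1 / qpoch q q (2 * i + e)) * norm (1 / qpoch q q (2 * j + p)))
        \<le> norm q ^ i * norm q ^ j / norm q * (C * C)"
      using 1 2 by (rule mult_mono) auto
    then show "norm (case x of (i, j) \<Rightarrow>
          q powi double_exponent d p i j / (qpoch q q (2 * i + e) * qpoch q q (2 * j + p)))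
        \<le> (case x of (i, j) \<Rightarrow> (C * C / norm q * norm q ^ i) * norm q ^ j)"
      by (simp add: x norm_divide norm_mult mult_ac)
  qed
  then show ?thesis by (rule abs_summable_summable)
qed

lemma double_sum_reduce:
  fixes q :: complex
  assumes "norm q < 1" "q \<noteq> 0" "p < 2"
    and outer: "((\<lambda>i. q ^ (i * i + d * i) * (qpoch (-q) q i / qpoch q q (2 * i + e))) has_sum S) UNIV"
  shows "((\<lambda>(i, j). q powi double_exponent d p i j / (qpoch q q (2 * i + e) * qpoch q q (2 * j + p)))
    has_sum S * qpoch_inf (-q) q) (UNIV \<times> UNIV)"
proof (rule has_sum_SigmaI)
  show "((\<lambda>i. q ^ (i * i + d * i) * (qpoch (-q) q i / qpoch q q (2 * i + e)) * qpoch_inf (-q) q)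
      has_sum S * qpoch_inf (-q) q) UNIV"
    by (intro has_sum_cmult_left outer)
  fix i
  \<comment> \<open>Everything in row i that does not depend on j; its factor q^(i(i+1)/2) cancels
    the denominator in \<open>euler_parity_has_sum\<close>.\<close>
  define c where "c = q ^ (i * i + d * i) * q ^ (i * (i + 1) div 2) / qpoch q q (2 * i + e)"
  have "((\<lambda>j. c * (euler_coeff q (2 * j + p) * ((1 / q) ^ i) ^ (2 * j + p))) has_sum
      c * (qpoch (-q) q i * qpoch_inf (-q) q / q ^ (i * (i + 1) div 2))) UNIV"
    by (intro has_sum_cmult_right euler_parity_has_sum assms)
  also have "c * (qpoch (-q) q i * qpoch_inf (-q) q / q ^ (i * (i + 1) div 2))
      = q ^ (i * i + d * i) * (qpoch (-q) q i / qpoch q q (2 * i + e)) * qpoch_inf (-q) q"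
    using assms(2) by (simp add: c_def)
  also have "(\<lambda>j. c * (euler_coeff q (2 * j + p) * ((1 / q) ^ i) ^ (2 * j + p)))
      = (\<lambda>j. q powi double_exponent d p i j / (qpoch q q (2 * i + e) * qpoch q q (2 * j + p)))"
  proof
    fix j
    define m where "m = 2 * j + p"
    have "double_exponent d p i j
        = int ((i * i + d * i) + i * (i + 1) div 2 + m * (m - 1) div 2) - int (i * m)"
      by (simp add: double_exponent_def m_def)
    then have "q powi double_exponent d p i j
        = q ^ (i * i + d * i) * q ^ (i * (i + 1) div 2) * q ^ (m * (m - 1) div 2) / q ^ (i * m)"
      using power_int_diff[OF disjI1[OF assms(2)]] by (simp only: power_int_of_nat power_add)
    moreover have "((1 / q) ^ i) ^ m = 1 / q ^ (i * m)"
      by (simp add: power_divide power_mult)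
    ultimately show "c * (euler_coeff q (2 * j + p) * ((1 / q) ^ i) ^ (2 * j + p))
        = q powi double_exponent d p i j / (qpoch q q (2 * i + e) * qpoch q q (2 * j + p))"
      unfolding c_def euler_coeff_def m_def[symmetric] by simp
  qed
  finally show "((\<lambda>j. case (i, j) of (i, j) \<Rightarrow>
        q powi double_exponent d p i j / (qpoch q q (2 * i + e) * qpoch q q (2 * j + p)))
      has_sum q ^ (i * i + d * i) * (qpoch (-q) q i / qpoch q q (2 * i + e)) * qpoch_inf (-q) q) UNIV"
    by simp
next
  show "(\<lambda>(i, j). q powi double_exponent d p i j / (qpoch q q (2 * i + e) * qpoch q q (2 * j + p)))
    summable_on UNIV \<times> UNIV"
    by (rule double_exponent_summable[OF assms(1,2)])
qed

text \<open>\<open>min d 1\<close> encodes the offsets 0, 1, 1 that belong to d = 0, 1, 2.\<close>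

lemma rogers_mod14_has_sum:
  fixes q :: complex
  assumes "norm q < 1" "q \<noteq> 0" "d \<le> 2"
  shows "((\<lambda>i. q ^ (i * i + d * i) * (qpoch (-q) q i / qpoch q q (2 * i + min d 1)))
    has_sum qpoch_inf (q ^ (8 + 2 * d)) (q ^ 14) * qpoch_inf (q ^ (6 - 2 * d)) (q ^ 14)
       * qpoch_inf (q ^ 14) (q ^ 14) / qpoch_inf q q) UNIV"
proof -
  have "bilateral q (rogers_weight q) (int n) (int n + int d) = qpoch (-q) q n / qpoch q q (2 * n + min d 1)" for n
  proof -
    consider "d = 0" | "d = 1" | "d = 2"
      using assms(3) by linarith
    then show ?thesis
      by cases (simp_all add: bilateral_rogers_0 bilateral_rogers_1 bilateral_rogers_2 assms)
  qed
  then show ?thesis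
    using rogers_bailey_has_sum[OF assms] by simp
qed

lemma qpoch_inf_0 [simp]: "qpoch_inf 0 q = 1"
  by (simp add: qpoch_inf_def)

theorem double_sum_eval:
  fixes q :: complex
  assumes "norm q < 1" "p < 2" "d \<le> 2"
  shows "((\<lambda>(i, j). q powi double_exponent d p i j / (qpoch q q (2 * i + min d 1) * qpoch q q (2 * j + p)))
    has_sum qpoch_inf (-q) q * qpoch_inf (q ^ (8 + 2 * d)) (q ^ 14) * qpoch_inf (q ^ (6 - 2 * d)) (q ^ 14)
       * qpoch_inf (q ^ 14) (q ^ 14) / qpoch_inf q q) UNIV"
proof (cases "q = 0")
  case False
  from double_sum_reduce[OF assms(1) False assms(2) rogers_mod14_has_sum[OF assms(1) False assms(3)]]
  show ?thesis by (simp add: mult_ac)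
next
  case True
  \<comment> \<open>The exponent 6 - 2d is positive, so at q = 0 every product on the right has
    parameter 0 and equals 1.\<close>
  have "(0 :: complex) ^ (6 - 2 * d) = 0"
    using assms(3) by (simp add: power_0_left)
  have "qpoch 0 0 n = 1" for n
    by (simp add: qpoch_def)
  then have "((\<lambda>(i, j). q powi double_exponent d p i j
      / (qpoch q q (2 * i + min d 1) * qpoch q q (2 * j + p))) has_sum 1) UNIV"
    by (intro has_sum_finite_neutralI[of "{(0, 0)}"])
      (auto simp: True power_int_0_left_if double_exponent_eq_0_iff[OF assms(2)] split: if_splits)
  then show ?thesis
    using \<open>0 ^ (6 - 2 * d) = 0\<close> by (simp add: True power_0_left)
qed

section \<open>Product sides and the final exponents\<close>

lemma qpoch_inf_q2:
  assumes "norm q < 1"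
  shows "qpoch_inf (q ^ 2) (q ^ 2) = qpoch_inf_list [q ^ 2, q ^ 4, q ^ 6, q ^ 8, q ^ 10, q ^ 12, q ^ 14] (q ^ 14)"
proof -
  have "qpoch_inf (q ^ 2) (q ^ 2) = (\<Prod>j<7. qpoch_inf (q ^ (2 + 2 * j)) (q ^ 14))"
    using qpoch_inf_dissect[of "q ^ 2" 7 "q ^ 2"] assms
    by (simp add: norm_power power_less_one_iff flip: power_mult power_add)
  also have "{..<7 :: nat} = {0, 1, 2, 3, 4, 5, 6}"
    by auto
  finally show ?thesis
    by (simp add: qpoch_inf_list_def mult_ac del: add_2_eq_Suc add_2_eq_Suc' power_Suc)
qed

text \<open>The square has two sources: (-q;q)_inf = 1/(q;q^2)_inf, and (q;q)_inf = (q;q^2)_inf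
  (q^2;q^2)_inf. The list \<open>as\<close> is whatever the theta factors leave over of
  (q^2;q^2)_inf.\<close>

lemma theta_quotient:
  assumes "norm q < 1"
    and "A * B * qpoch_inf (q ^ 14) (q ^ 14) * qpoch_inf_list as (q ^ 14) = qpoch_inf (q ^ 2) (q ^ 2)"
  shows "qpoch_inf (-q) q * A * B * qpoch_inf (q ^ 14) (q ^ 14) / qpoch_inf q q
    = 1 / (qpoch_inf q (q ^ 2) ^ 2 * qpoch_inf_list as (q ^ 14))"
proof -
  define u where "u = qpoch_inf q (q ^ 2)"
  define P where "P = qpoch_inf (q ^ 2) (q ^ 2)"
  have q2: "norm (q ^ 2) < 1"
    using assms(1) by (simp add: norm_power power_less_one_iff)
  have "u \<noteq> 0" "P \<noteq> 0"
    unfolding u_def P_def using assms(1) q2 by (simp_all only: qpoch_inf_nonzero not_False_eq_True)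
  moreover have q: "qpoch_inf q q = u * P"
    using qpoch_inf_dissect[OF assms(1), of 2 q] by (simp add: u_def P_def numeral_2_eq_2)
  moreover have "qpoch_inf q q * qpoch_inf (-q) q = P"
    using qpoch_inf_square[OF assms(1), of q] by (simp add: P_def)
  ultimately have "qpoch_inf (-q) q = 1 / u"
    by (simp add: eq_divide_eq mult.commute[of _ u])
  moreover define L where "L = qpoch_inf_list as (q ^ 14)"
  moreover define W where "W = qpoch_inf (q ^ 14) (q ^ 14)"
  \<comment> \<open>As P is nonzero, so are all four factors, and they may be cancelled.\<close>
  moreover have P: "P = A * B * W * L"
    using assms(2) by (simp add: P_def L_def W_def)
  ultimately show ?thesis
    unfolding q u_def[symmetric] L_def[symmetric] W_def[symmetric]
    using \<open>u \<noteq> 0\<close> \<open>P \<noteq> 0\<close> by (simp add: P power2_eq_square)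
qed

text \<open>Since p^2 = p for p in {0, 1}, no constant remains and the part involving j is integral
  after halving; only the quadratic in i needs \<open>div\<close>. The term -p i of the cross
  product moves into its linear coefficient.\<close>

lemma double_exponent_div:
  assumes "p < 2"
  shows "double_exponent d p i j = (3 * int i ^ 2 + (2 * int d + 1 - 2 * int p) * int i) div 2
     - 2 * int i * int j + 2 * int j ^ 2 + (2 * int p - 1) * int j"
proof -
  have "int p = 0 \<or> int p = 1"
    using assms by linarith
  then have "2 * double_exponent d p i j = (3 * int i ^ 2 + (2 * int d + 1 - 2 * int p) * int i)
     + 2 * (- 2 * int i * int j + 2 * int j ^ 2 + (2 * int p - 1) * int j)"
    unfolding double_exponent_twice by (auto simp: algebra_simps power2_eq_square)
  then have "double_exponent d p i j = ((3 * int i ^ 2 + (2 * int d + 1 - 2 * int p) * int i)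
     + 2 * (- 2 * int i * int j + 2 * int j ^ 2 + (2 * int p - 1) * int j)) div 2"
    by simp
  then show ?thesis by simp
qed

lemma double_sum_product:
  fixes q :: complex
  assumes "norm q < 1" "p < 2" "d \<le> 2"
    and "qpoch_inf (q ^ (8 + 2 * d)) (q ^ 14) * qpoch_inf (q ^ (6 - 2 * d)) (q ^ 14)
       * qpoch_inf (q ^ 14) (q ^ 14) * qpoch_inf_list as (q ^ 14) = qpoch_inf (q ^ 2) (q ^ 2)"
  shows "((\<lambda>(i, j). q powi ((3 * int i ^ 2 + (2 * int d + 1 - 2 * int p) * int i) div 2
          - 2 * int i * int j + 2 * int j ^ 2 + (2 * int p - 1) * int j)
        / (qpoch q q (2 * i + min d 1) * qpoch q q (2 * j + p)))
    has_sum 1 / (qpoch_inf q (q ^ 2) ^ 2 * qpoch_inf_list as (q ^ 14))) UNIV"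
  using double_sum_eval[OF assms(1-3)]
  unfolding theta_quotient[OF assms(1,4)] double_exponent_div[OF assms(2)] .

theorem theorem5p2:
  fixes q :: complex
  assumes "norm q < 1"
  shows "((\<lambda>(i, j). q powi ((3 * int i ^ 2 + int i) div 2 - 2 * int i * int j + 2 * int j ^ 2 - int j)
             / (qpoch q q (2 * i) * qpoch q q (2 * j)))
          has_sum 1 / (qpoch_inf q (q ^ 2) ^ 2 * qpoch_inf_list [q ^ 2, q ^ 4, q ^ 10, q ^ 12] (q ^ 14)))
          (UNIV :: (nat \<times> nat) set)
    \<and> ((\<lambda>(i, j). q powi ((3 * int i ^ 2 - int i) div 2 - 2 * int i * int j + 2 * int j ^ 2 + int j)
             / (qpoch q q (2 * i) * qpoch q q (2 * j + 1)))
          has_sum 1 / (qpoch_inf q (q ^ 2) ^ 2 * qpoch_inf_list [q ^ 2, q ^ 4, q ^ 10, q ^ 12] (q ^ 14)))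
          (UNIV :: (nat \<times> nat) set)
    \<and> ((\<lambda>(i, j). q powi ((3 * int i ^ 2 + 3 * int i) div 2 - 2 * int i * int j + 2 * int j ^ 2 - int j)
             / (qpoch q q (2 * i + 1) * qpoch q q (2 * j)))
          has_sum 1 / (qpoch_inf q (q ^ 2) ^ 2 * qpoch_inf_list [q ^ 2, q ^ 6, q ^ 8, q ^ 12] (q ^ 14)))
          (UNIV :: (nat \<times> nat) set)
    \<and> ((\<lambda>(i, j). q powi ((3 * int i ^ 2 + int i) div 2 - 2 * int i * int j + 2 * int j ^ 2 + int j)
             / (qpoch q q (2 * i + 1) * qpoch q q (2 * j + 1)))
          has_sum 1 / (qpoch_inf q (q ^ 2) ^ 2 * qpoch_inf_list [q ^ 2, q ^ 6, q ^ 8, q ^ 12] (q ^ 14)))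
          (UNIV :: (nat \<times> nat) set)
    \<and> ((\<lambda>(i, j). q powi ((3 * int i ^ 2 + 5 * int i) div 2 - 2 * int i * int j + 2 * int j ^ 2 - int j)
             / (qpoch q q (2 * i + 1) * qpoch q q (2 * j)))
          has_sum 1 / (qpoch_inf q (q ^ 2) ^ 2 * qpoch_inf_list [q ^ 4, q ^ 6, q ^ 8, q ^ 10] (q ^ 14)))
          (UNIV :: (nat \<times> nat) set)
    \<and> ((\<lambda>(i, j). q powi ((3 * int i ^ 2 + 3 * int i) div 2 - 2 * int i * int j + 2 * int j ^ 2 + int j)
             / (qpoch q q (2 * i + 1) * qpoch q q (2 * j + 1)))
          has_sum 1 / (qpoch_inf q (q ^ 2) ^ 2 * qpoch_inf_list [q ^ 4, q ^ 6, q ^ 8, q ^ 10] (q ^ 14)))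
          (UNIV :: (nat \<times> nat) set)"
proof -
  note split = qpoch_inf_q2[OF assms] qpoch_inf_list_def
  \<comment> \<open>Of the even exponents 2, ..., 14 the theta product takes 8, 6, 14 for d = 0; 10,
    4, 14 for d = 1; and 12, 2, 14 for d = 2. The listed four are the complement in each
    case.\<close>
  have "qpoch_inf (q ^ (8 + 2 * 0)) (q ^ 14) * qpoch_inf (q ^ (6 - 2 * 0)) (q ^ 14)
      * qpoch_inf (q ^ 14) (q ^ 14) * qpoch_inf_list [q ^ 2, q ^ 4, q ^ 10, q ^ 12] (q ^ 14)
      = qpoch_inf (q ^ 2) (q ^ 2)"
    unfolding split by simp
  note sum0 = double_sum_product[OF assms _ _ this]
  have "qpoch_inf (q ^ (8 + 2 * 1)) (q ^ 14) * qpoch_inf (q ^ (6 - 2 * 1)) (q ^ 14)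
      * qpoch_inf (q ^ 14) (q ^ 14) * qpoch_inf_list [q ^ 2, q ^ 6, q ^ 8, q ^ 12] (q ^ 14)
      = qpoch_inf (q ^ 2) (q ^ 2)"
    unfolding split by simp
  note sum1 = double_sum_product[OF assms _ _ this]
  have "qpoch_inf (q ^ (8 + 2 * 2)) (q ^ 14) * qpoch_inf (q ^ (6 - 2 * 2)) (q ^ 14)
      * qpoch_inf (q ^ 14) (q ^ 14) * qpoch_inf_list [q ^ 4, q ^ 6, q ^ 8, q ^ 10] (q ^ 14)
      = qpoch_inf (q ^ 2) (q ^ 2)"
    unfolding split by simp
  note sum2 = double_sum_product[OF assms _ _ this]
  \<comment> \<open>Each d yields two of the six sums, with p = 0 and p = 1 as the parity of the
    second index.\<close>
  show ?thesis
    using sum0[of 0] sum0[of 1] sum1[of 0] sum1[of 1] sum2[of 0] sum2[of 1]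
    by (intro conjI) simp_all
qed

end
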